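(* Let $\psi$ be a $\mathcal{T}$-formula in d-DNNF which is $\mathcal{T}$-extended with respect to a finite set of atoms $\boldsymbol{\alpha}$ containing its atoms, and let $\gamma$ be a cube on $\boldsymbol{\alpha}$. Then: (a) the $\mathcal{T}$-validity of $\psi$ can be decided in time polynomial in the size of $\psi$; (b) whether $\gamma\models_{\mathcal{T}}\psi$ can be decided in time polynomial in the sizes of $\psi$ and $\gamma$.
   Context: $\mathcal{T}$-formulas are quantifier-free formulas built by Boolean connectives from $\mathcal{T}$-atoms and Boolean atoms, represented as DAGs; size is the number of DAG nodes. The Boolean abstraction maps each atom bijectively to a fresh Boolean variable; $\psi\models_p\chi$ means the abstraction of $\psi$ propositionally entails that of $\chi$. d-DNNF: negation normal form in which the children of every $\wedge$-node share no atoms and the children of every $\vee$-node are pairwise propositionally inconsistent; a $\mathcal{T}$-formula is in d-DNNF iff its Boolean abstraction is. A cube is a conjunction of literals. A total truth assignment on $\boldsymbol{\alpha}$ is a conjunction containing, for each $a\in\boldsymbol{\alpha}$, exactly one of $a,\neg a$. $P_{\boldsymbol{\alpha}}(\chi)$ is the set of $\mathcal{T}$-unsatisfiable total truth assignments $\rho$ on $\boldsymbol{\alpha}$ with $\rho\models_p\chi$; $\psi$ is $\mathcal{T}$-extended with respect to $\boldsymbol{\alpha}$ iff $P_{\boldsymbol{\alpha}}(\neg\psi)=\emptyset$. *)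

theory Defs
  imports "HOL-Computational_Algebra.Polynomial"
begin

section \<open>Quantifier-free formulas and their Boolean abstraction\<close>

text \<open>The constants true and false are the empty conjunction and the empty disjunction.\<close>

datatype (atoms: 'a) fm =
    Atom 'a
  | Neg "'a fm"
  | And "'a fm list"
  | Or "'a fm list"

fun holds :: "('a \<Rightarrow> bool) \<Rightarrow> 'a fm \<Rightarrow> bool" where
  "holds v (Atom a) \<longleftrightarrow> v a"
| "holds v (Neg f) \<longleftrightarrow> \<not> holds v f"
| "holds v (And fs) \<longleftrightarrow> (\<forall>f\<in>set fs. holds v f)"
| "holds v (Or fs) \<longleftrightarrow> (\<exists>f\<in>set fs. holds v f)"

fun subfms :: "'a fm \<Rightarrow> 'a fm set" where
  "subfms (Atom a) = {Atom a}"
| "subfms (Neg f) = insert (Neg f) (subfms f)"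
| "subfms (And fs) = insert (And fs) (\<Union>f\<in>set fs. subfms f)"
| "subfms (Or fs) = insert (Or fs) (\<Union>f\<in>set fs. subfms f)"

datatype 'a bvar = BVar 'a

definition abstraction :: "'a fm \<Rightarrow> 'a bvar fm" where
  "abstraction f = map_fm BVar f"

definition prop_entails :: "'a fm \<Rightarrow> 'a fm \<Rightarrow> bool" where
  "prop_entails f g \<longleftrightarrow> (\<forall>v. holds v f \<longrightarrow> holds v g)"

definition prop_inconsistent :: "'a fm \<Rightarrow> 'a fm \<Rightarrow> bool" where
  "prop_inconsistent f g \<longleftrightarrow> \<not> (\<exists>v. holds v f \<and> holds v g)"

definition entails_p :: "'a fm \<Rightarrow> 'a fm \<Rightarrow> bool" where
  "entails_p f g \<longleftrightarrow> prop_entails (abstraction f) (abstraction g)"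

definition nnf :: "'a fm \<Rightarrow> bool" where
  "nnf f \<longleftrightarrow> (\<forall>g. Neg g \<in> subfms f \<longrightarrow> (\<exists>a. g = Atom a))"

definition decomposable :: "'a fm \<Rightarrow> bool" where
  "decomposable f \<longleftrightarrow> (\<forall>fs. And fs \<in> subfms f \<longrightarrow>
     (\<forall>i j. i < j \<and> j < length fs \<longrightarrow> atoms (fs ! i) \<inter> atoms (fs ! j) = {}))"

definition deterministic :: "'a fm \<Rightarrow> bool" where
  "deterministic f \<longleftrightarrow> (\<forall>fs. Or fs \<in> subfms f \<longrightarrow>
     (\<forall>i j. i < j \<and> j < length fs \<longrightarrow> prop_inconsistent (fs ! i) (fs ! j)))"

definition d_DNNF :: "'a fm \<Rightarrow> bool" where
  "d_DNNF f \<longleftrightarrow> nnf f \<and> decomposable f \<and> deterministic f"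

definition is_literal :: "'a fm \<Rightarrow> bool" where
  "is_literal f \<longleftrightarrow> (\<exists>a. f = Atom a \<or> f = Neg (Atom a))"

definition is_cube :: "'a fm \<Rightarrow> bool" where
  "is_cube f \<longleftrightarrow> is_literal f \<or> (\<exists>ls. f = And ls \<and> (\<forall>l\<in>set ls. is_literal l))"

definition total_assignment :: "'a set \<Rightarrow> 'a fm \<Rightarrow> bool" where
  "total_assignment \<alpha> \<rho> \<longleftrightarrow> (\<exists>ls. \<rho> = And ls \<and> (\<forall>l\<in>set ls. is_literal l) \<and> atoms \<rho> \<subseteq> \<alpha> \<and>
     (\<forall>a\<in>\<alpha>. (Atom a \<in> set ls) \<noteq> (Neg (Atom a) \<in> set ls)))"


section \<open>Theories\<close>

text \<open>Many-sorted first-order logic with equality. A theory is given by its class of models.\<close>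

datatype ('f, 'v) trm = Var 'v | App 'f "('f, 'v) trm list"

datatype ('p, 'f, 'v, 'b) atom =
    BoolAtom 'b
  | PredAtom 'p "('f, 'v) trm list"
  | EqAtom "('f, 'v) trm" "('f, 'v) trm"

record ('p, 'f, 'v, 's) signature =
  var_sort :: "'v \<Rightarrow> 's"
  fun_args :: "'f \<Rightarrow> 's list"
  fun_sort :: "'f \<Rightarrow> 's"
  pred_args :: "'p \<Rightarrow> 's list"

inductive has_sort :: "('p, 'f, 'v, 's) signature \<Rightarrow> ('f, 'v) trm \<Rightarrow> 's \<Rightarrow> bool" for \<Sigma> where
  "has_sort \<Sigma> (Var x) (var_sort \<Sigma> x)"
| "list_all2 (has_sort \<Sigma>) ts (fun_args \<Sigma> f) \<Longrightarrow> has_sort \<Sigma> (App f ts) (fun_sort \<Sigma> f)"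

fun well_sorted :: "('p, 'f, 'v, 's) signature \<Rightarrow> ('p, 'f, 'v, 'b) atom \<Rightarrow> bool" where
  "well_sorted \<Sigma> (BoolAtom b) \<longleftrightarrow> True"
| "well_sorted \<Sigma> (PredAtom p ts) \<longleftrightarrow> list_all2 (has_sort \<Sigma>) ts (pred_args \<Sigma> p)"
| "well_sorted \<Sigma> (EqAtom t u) \<longleftrightarrow> (\<exists>s. has_sort \<Sigma> t s \<and> has_sort \<Sigma> u s)"

record ('p, 'f, 's, 'u) struct =
  domain :: "'s \<Rightarrow> 'u set"
  fun_int :: "'f \<Rightarrow> 'u list \<Rightarrow> 'u"
  pred_int :: "'p \<Rightarrow> 'u list \<Rightarrow> bool"

definition is_struct :: "('p, 'f, 'v, 's) signature \<Rightarrow> ('p, 'f, 's, 'u) struct \<Rightarrow> bool" where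
  "is_struct \<Sigma> M \<longleftrightarrow> (\<forall>s. domain M s \<noteq> {}) \<and>
     (\<forall>f us. list_all2 (\<lambda>u s. u \<in> domain M s) us (fun_args \<Sigma> f) \<longrightarrow>
        fun_int M f us \<in> domain M (fun_sort \<Sigma> f))"

definition is_theory :: "('p, 'f, 'v, 's) signature \<Rightarrow> ('p, 'f, 's, 'u) struct set \<Rightarrow> bool" where
  "is_theory \<Sigma> T \<longleftrightarrow> (\<forall>M\<in>T. is_struct \<Sigma> M)"

text \<open>A model of the theory, values for the variables, and truth values for the Boolean atoms.\<close>

type_synonym ('p, 'f, 'v, 'b, 's, 'u) interp =
  "('p, 'f, 's, 'u) struct \<times> ('v \<Rightarrow> 'u) \<times> ('b \<Rightarrow> bool)"

definition interps ::
  "('p, 'f, 'v, 's) signature \<Rightarrow> ('p, 'f, 's, 'u) struct set \<Rightarrow> ('p, 'f, 'v, 'b, 's, 'u) interp set"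
where
  "interps \<Sigma> T = {(M, \<nu>, \<beta>). M \<in> T \<and> (\<forall>x. \<nu> x \<in> domain M (var_sort \<Sigma> x))}"

fun trm_val :: "('p, 'f, 's, 'u) struct \<Rightarrow> ('v \<Rightarrow> 'u) \<Rightarrow> ('f, 'v) trm \<Rightarrow> 'u" where
  "trm_val M \<nu> (Var x) = \<nu> x"
| "trm_val M \<nu> (App f ts) = fun_int M f (map (trm_val M \<nu>) ts)"

fun atom_val :: "('p, 'f, 'v, 'b, 's, 'u) interp \<Rightarrow> ('p, 'f, 'v, 'b) atom \<Rightarrow> bool" where
  "atom_val (M, \<nu>, \<beta>) (BoolAtom b) \<longleftrightarrow> \<beta> b"
| "atom_val (M, \<nu>, \<beta>) (PredAtom p ts) \<longleftrightarrow> pred_int M p (map (trm_val M \<nu>) ts)"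
| "atom_val (M, \<nu>, \<beta>) (EqAtom t u) \<longleftrightarrow> trm_val M \<nu> t = trm_val M \<nu> u"

definition T_satisfiable ::
  "('p, 'f, 'v, 's) signature \<Rightarrow> ('p, 'f, 's, 'u) struct set \<Rightarrow> ('p, 'f, 'v, 'b) atom fm \<Rightarrow> bool"
where
  "T_satisfiable \<Sigma> T f \<longleftrightarrow> (\<exists>I\<in>interps \<Sigma> T. holds (atom_val I) f)"

definition T_valid ::
  "('p, 'f, 'v, 's) signature \<Rightarrow> ('p, 'f, 's, 'u) struct set \<Rightarrow> ('p, 'f, 'v, 'b) atom fm \<Rightarrow> bool"
where
  "T_valid \<Sigma> T f \<longleftrightarrow> (\<forall>I\<in>interps \<Sigma> T. holds (atom_val I) f)"

definition T_entails ::
  "('p, 'f, 'v, 's) signature \<Rightarrow> ('p, 'f, 's, 'u) struct set \<Rightarrow>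
   ('p, 'f, 'v, 'b) atom fm \<Rightarrow> ('p, 'f, 'v, 'b) atom fm \<Rightarrow> bool"
where
  "T_entails \<Sigma> T f g \<longleftrightarrow>
     (\<forall>I\<in>interps \<Sigma> T. holds (atom_val I) f \<longrightarrow> holds (atom_val I) g)"

definition T_inconsistent_assignments ::
  "('p, 'f, 'v, 's) signature \<Rightarrow> ('p, 'f, 's, 'u) struct set \<Rightarrow>
   ('p, 'f, 'v, 'b) atom set \<Rightarrow> ('p, 'f, 'v, 'b) atom fm \<Rightarrow> ('p, 'f, 'v, 'b) atom fm set"
where
  "T_inconsistent_assignments \<Sigma> T \<alpha> \<chi> =
     {\<rho>. total_assignment \<alpha> \<rho> \<and> \<not> T_satisfiable \<Sigma> T \<rho> \<and> entails_p \<rho> \<chi>}"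

definition T_extended ::
  "('p, 'f, 'v, 's) signature \<Rightarrow> ('p, 'f, 's, 'u) struct set \<Rightarrow>
   ('p, 'f, 'v, 'b) atom set \<Rightarrow> ('p, 'f, 'v, 'b) atom fm \<Rightarrow> bool"
where
  "T_extended \<Sigma> T \<alpha> \<psi> \<longleftrightarrow> T_inconsistent_assignments \<Sigma> T \<alpha> (Neg \<psi>) = {}"


section \<open>Formulas as DAGs\<close>

text \<open>
  A DAG is listed in topological order, children before parents; the root is the last node.
  Edges are not labelled, so the children of a node are distinct, and every node other than the
  root has a parent. Sharing need not be maximal.
\<close>

datatype 'a node = NAtom 'a | NNot nat | NAnd "nat list" | NOr "nat list"

type_synonym 'a dag = "'a node list"

fun children :: "'a node \<Rightarrow> nat list" where
  "children (NAtom a) = []"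
| "children (NNot i) = [i]"
| "children (NAnd is) = is"
| "children (NOr is) = is"

definition is_dag :: "'a dag \<Rightarrow> bool" where
  "is_dag ns \<longleftrightarrow> ns \<noteq> [] \<and>
     (\<forall>i<length ns. distinct (children (ns ! i)) \<and> (\<forall>c\<in>set (children (ns ! i)). c < i)) \<and>
     (\<forall>i. Suc i < length ns \<longrightarrow> (\<exists>j<length ns. i \<in> set (children (ns ! j))))"

definition dag_size :: "'a dag \<Rightarrow> nat" where
  "dag_size ns = length ns"

fun node_fm :: "'a fm list \<Rightarrow> 'a node \<Rightarrow> 'a fm" where
  "node_fm fs (NAtom a) = Atom a"
| "node_fm fs (NNot i) = Neg (fs ! i)"
| "node_fm fs (NAnd is) = And (map (\<lambda>i. fs ! i) is)"
| "node_fm fs (NOr is) = Or (map (\<lambda>i. fs ! i) is)"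

definition dag_fms :: "'a dag \<Rightarrow> 'a fm list" where
  "dag_fms ns = foldl (\<lambda>fs n. fs @ [node_fm fs n]) [] ns"

definition dag_fm :: "'a dag \<Rightarrow> 'a fm" where
  "dag_fm ns = last (dag_fms ns)"


section \<open>Polynomial-time computation\<close>

text \<open>
  The machine model is a first-order, call-by-value functional language over binary trees, in the
  style of N. D. Jones (Computability and Complexity from a Programming Perspective). Every
  evaluation step costs one time unit; there are no numbers and no test for equality of trees, and
  subtrees are shared by reference, so that polynomial time in this model is polynomial time on
  Turing machines. A program is a finite list of function bodies, the first of which is the main
  function. The conditional tests whether a tree is a branch, and both projections of a leaf are a
  leaf.
\<close>

datatype tree = Lf | Br tree tree

datatype expr =
    Arg nat
  | ELf
  | EBr expr expr
  | ELeft expr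
  | ERight expr
  | EIf expr expr expr
  | ECall nat "expr list"

type_synonym program = "expr list"

fun left :: "tree \<Rightarrow> tree" where
  "left Lf = Lf"
| "left (Br s t) = s"

fun right :: "tree \<Rightarrow> tree" where
  "right Lf = Lf"
| "right (Br s t) = t"

inductive
  eval :: "program \<Rightarrow> tree list \<Rightarrow> expr \<Rightarrow> tree \<Rightarrow> nat \<Rightarrow> bool" and
  evals :: "program \<Rightarrow> tree list \<Rightarrow> expr list \<Rightarrow> tree list \<Rightarrow> nat \<Rightarrow> bool"
  for P :: program
where
  eval_Arg: "i < length env \<Longrightarrow> eval P env (Arg i) (env ! i) 1"
| eval_Lf: "eval P env ELf Lf 1"
| eval_Br: "eval P env e u k \<Longrightarrow> eval P env e' u' k' \<Longrightarrow>
    eval P env (EBr e e') (Br u u') (Suc (k + k'))"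
| eval_Left: "eval P env e u k \<Longrightarrow> eval P env (ELeft e) (left u) (Suc k)"
| eval_Right: "eval P env e u k \<Longrightarrow> eval P env (ERight e) (right u) (Suc k)"
| eval_If_Br: "eval P env e u k \<Longrightarrow> u \<noteq> Lf \<Longrightarrow> eval P env e1 w k' \<Longrightarrow>
    eval P env (EIf e e1 e2) w (Suc (k + k'))"
| eval_If_Lf: "eval P env e Lf k \<Longrightarrow> eval P env e2 w k' \<Longrightarrow>
    eval P env (EIf e e1 e2) w (Suc (k + k'))"
| eval_Call: "g < length P \<Longrightarrow> evals P env es us k \<Longrightarrow> eval P us (P ! g) w k' \<Longrightarrow>
    eval P env (ECall g es) w (Suc (k + k'))"
| evals_Nil: "evals P env [] [] 0"
| evals_Cons: "eval P env e u k \<Longrightarrow> evals P env es us k' \<Longrightarrow>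
    evals P env (e # es) (u # us) (k + k')"

lemma eval_deterministic:
  "eval P env e u k \<Longrightarrow> eval P env e u' k' \<Longrightarrow> u = u' \<and> k = k'"
  "evals P env es us k \<Longrightarrow> evals P env es us' k' \<Longrightarrow> us = us' \<and> k = k'"
proof (induction arbitrary: u' k' and us' k' rule: eval_evals.inducts)
  case (eval_Arg i env)
  then show ?case by (auto elim: eval.cases)
next
  case (eval_Lf env)
  then show ?case by (auto elim: eval.cases)
next
  case (eval_Br env e u k e' u' k')
  from eval_Br.prems show ?case by (cases rule: eval.cases) (use eval_Br.IH in blast)+
next
  case (eval_Left env e u k)
  from eval_Left.prems show ?case by (cases rule: eval.cases) (use eval_Left.IH in blast)+
next
  case (eval_Right env e u k)
  from eval_Right.prems show ?case by (cases rule: eval.cases) (use eval_Right.IH in blast)+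
next
  case (eval_If_Br env e u k e1 w k' e2)
  from eval_If_Br.prems show ?case
    by (cases rule: eval.cases) (use eval_If_Br.IH eval_If_Br.hyps in blast)+
next
  case (eval_If_Lf env e k e2 w k' e1)
  from eval_If_Lf.prems show ?case by (cases rule: eval.cases) (use eval_If_Lf.IH in blast)+
next
  case (eval_Call g env es us k w k')
  from eval_Call.prems show ?case by (cases rule: eval.cases) (use eval_Call.IH in blast)+
next
  case (evals_Nil env)
  then show ?case by (auto elim: evals.cases)
next
  case (evals_Cons env e u k es us k')
  from evals_Cons.prems show ?case by (cases rule: evals.cases) (use evals_Cons.IH in blast)+
qed

definition decides_within :: "program \<Rightarrow> tree list \<Rightarrow> bool \<Rightarrow> nat \<Rightarrow> bool" where
  "decides_within P inputs b n \<longleftrightarrow> P \<noteq> [] \<and>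
     (\<exists>u k. eval P inputs (hd P) u k \<and> k \<le> n \<and> (u \<noteq> Lf \<longleftrightarrow> b))"

text \<open>
  Numbers are written in unary. They occur as node indices and as names of atoms only, hence are
  bounded by the number of nodes.
\<close>

primrec enc_nat :: "nat \<Rightarrow> tree" where
  "enc_nat 0 = Lf"
| "enc_nat (Suc n) = Br Lf (enc_nat n)"

definition enc_list :: "tree list \<Rightarrow> tree" where
  "enc_list us = foldr Br us Lf"

fun enc_node :: "('a \<Rightarrow> nat) \<Rightarrow> 'a node \<Rightarrow> tree" where
  "enc_node num (NAtom a) = Br (enc_nat 0) (enc_nat (num a))"
| "enc_node num (NNot i) = Br (enc_nat 1) (enc_nat i)"
| "enc_node num (NAnd is) = Br (enc_nat 2) (enc_list (map enc_nat is))"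
| "enc_node num (NOr is) = Br (enc_nat 3) (enc_list (map enc_nat is))"

definition enc_dag :: "('a \<Rightarrow> nat) \<Rightarrow> 'a dag \<Rightarrow> tree" where
  "enc_dag num ns = enc_list (map (enc_node num) ns)"

text \<open>The Boolean variables of the abstraction, named by the numbers below their count.\<close>

definition is_numbering :: "('a \<Rightarrow> nat) \<Rightarrow> 'a set \<Rightarrow> bool" where
  "is_numbering num A \<longleftrightarrow> bij_betw num A {..<card A}"

end

theory Submission
  imports Defs
begin

text \<open>
  If \<open>\<psi>\<close> is \<open>T\<close>-extended, an assignment falsifying \<open>\<psi>\<close> but satisfying \<open>\<gamma>\<close> is \<open>T\<close>-satisfiable, so
  \<open>\<gamma> \<Turnstile>\<^sub>T \<psi>\<close> is propositional entailment; validity is the case of the empty cube.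

  Unless \<open>\<gamma>\<close> contains complementary literals, \<open>\<gamma> \<Turnstile>\<^sub>p \<psi>\<close> holds iff \<open>\<psi>\<close> has probability \<open>1\<close> when the
  atoms fixed by \<open>\<gamma>\<close> get probability \<open>0\<close> or \<open>1\<close> and the others, independently, \<open>1/2\<close>.
  Decomposability makes the probability of a conjunction the product, and determinism that of a
  disjunction the sum, of the probabilities of the children. With \<open>n\<close> nodes all probabilities are
  multiples of \<open>1/2\<^sup>n\<close>, so binary fixed-point arithmetic on \<open>n + 1\<close> bits is exact, and one pass over
  the DAG takes polynomial time.
\<close>

section \<open>Theory entailment and propositional entailment\<close>

lemma holds_cong: "(\<And>a. a \<in> atoms f \<Longrightarrow> v a = w a) \<Longrightarrow> holds v f = holds w f"
  by (induction f) auto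

lemma fm_cons_induct [case_names Atom Neg And_Nil And_Cons Or_Nil Or_Cons]:
  assumes "\<And>a. P (Atom a)" "\<And>f. P f \<Longrightarrow> P (Neg f)"
    and "P (And [])" "\<And>f fs. P f \<Longrightarrow> P (And fs) \<Longrightarrow> P (And (f # fs))"
    and "P (Or [])" "\<And>f fs. P f \<Longrightarrow> P (Or fs) \<Longrightarrow> P (Or (f # fs))"
  shows "P f"
proof (induction f)
  case (And fs)
  then show ?case by (induction fs) (simp_all add: assms)
next
  case (Or fs)
  then show ?case by (induction fs) (simp_all add: assms)
qed (simp_all add: assms)

lemma holds_map_fm: "holds v (map_fm h f) = holds (v \<circ> h) f"
  by (induction f) auto

lemma holds_abstraction: "holds v (abstraction f) = holds (v \<circ> BVar) f"
  by (simp add: abstraction_def holds_map_fm)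

lemma all_comp_BVar_iff: "(\<forall>v :: 'a bvar \<Rightarrow> 'b. P (v \<circ> BVar)) \<longleftrightarrow> (\<forall>v. P v)"
proof
  assume all_comp: "\<forall>v :: 'a bvar \<Rightarrow> 'b. P (v \<circ> BVar)"
  have "P v" for v
    using all_comp[rule_format, of "v \<circ> (\<lambda>x. case x of BVar a \<Rightarrow> a)"] by (simp add: comp_def)
  then show "\<forall>v. P v" ..
qed simp

lemma entails_p_iff_prop_entails: "entails_p f g \<longleftrightarrow> prop_entails f g"
  by (simp add: entails_p_def prop_entails_def holds_abstraction
      all_comp_BVar_iff[where P = "\<lambda>v. holds v f \<longrightarrow> holds v g"])

lemma prop_inconsistent_abstraction:
  "prop_inconsistent (abstraction f) (abstraction g) \<longleftrightarrow> prop_inconsistent f g"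
  using all_comp_BVar_iff[where P = "\<lambda>v. \<not> (holds v f \<and> holds v g)"]
  by (simp add: prop_inconsistent_def holds_abstraction)

lemma ex_total_assignment:
  assumes "finite \<alpha>"
  shows "\<exists>\<rho>. total_assignment \<alpha> \<rho> \<and> (\<forall>w. holds w \<rho> \<longleftrightarrow> (\<forall>a\<in>\<alpha>. w a = v a))"
proof -
  obtain as where as: "set as = \<alpha>" using finite_list[OF assms] by blast
  define \<rho> where "\<rho> = And (map (\<lambda>a. if v a then Atom a else Neg (Atom a)) as)"
  have "total_assignment \<alpha> \<rho>"
    unfolding total_assignment_def \<rho>_def using as
    by (auto simp: is_literal_def image_iff split: if_splits)
  moreover have "holds w \<rho> \<longleftrightarrow> (\<forall>a\<in>\<alpha>. w a = v a)" for w
  proof -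
    have "holds w (if v a then Atom a else Neg (Atom a)) \<longleftrightarrow> w a = v a" for a by simp
    then show ?thesis by (simp only: \<rho>_def holds.simps set_map ball_simps as)
  qed
  ultimately show ?thesis by blast
qed

lemma T_extended_interp:
  assumes "finite \<alpha>" "atoms \<psi> \<subseteq> \<alpha>" "T_extended \<Sigma> T \<alpha> \<psi>" "\<not> holds v \<psi>"
  shows "\<exists>I\<in>interps \<Sigma> T. \<forall>a\<in>\<alpha>. atom_val I a = v a"
proof -
  obtain \<rho> where total: "total_assignment \<alpha> \<rho>"
    and holds_\<rho>: "\<And>w. holds w \<rho> \<longleftrightarrow> (\<forall>a\<in>\<alpha>. w a = v a)"
    using ex_total_assignment[OF assms(1)] by metis
  have "\<not> holds w \<psi>" if "holds w \<rho>" for w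
    using that assms(2,4) holds_cong[of \<psi> w v] unfolding holds_\<rho> by blast
  then have "entails_p \<rho> (Neg \<psi>)"
    by (simp add: entails_p_iff_prop_entails prop_entails_def)
  then have "T_satisfiable \<Sigma> T \<rho>"
    using assms(3) total by (auto simp: T_extended_def T_inconsistent_assignments_def)
  then show ?thesis by (simp add: T_satisfiable_def holds_\<rho>)
qed

lemma T_entails_iff_prop_entails:
  assumes "finite \<alpha>" "atoms \<psi> \<subseteq> \<alpha>" "atoms \<gamma> \<subseteq> \<alpha>" "T_extended \<Sigma> T \<alpha> \<psi>"
  shows "T_entails \<Sigma> T \<gamma> \<psi> \<longleftrightarrow> prop_entails \<gamma> \<psi>"
proof
  assume T_entails: "T_entails \<Sigma> T \<gamma> \<psi>"
  show "prop_entails \<gamma> \<psi>"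
    unfolding prop_entails_def
  proof (intro allI impI, rule ccontr)
    fix v assume v: "holds v \<gamma>" "\<not> holds v \<psi>"
    obtain I where I: "I \<in> interps \<Sigma> T" "\<forall>a\<in>\<alpha>. atom_val I a = v a"
      using T_extended_interp[OF assms(1,2,4) v(2)] by blast
    have "holds (atom_val I) \<gamma>" "\<not> holds (atom_val I) \<psi>"
      using v I(2) assms(2,3) holds_cong[of \<gamma> "atom_val I" v] holds_cong[of \<psi> "atom_val I" v]
      by blast+
    then show False using T_entails I(1) by (auto simp: T_entails_def)
  qed
qed (simp add: prop_entails_def T_entails_def)

section \<open>Decomposability and determinism\<close>

lemma decomposable_iff_sorted_wrt:
  "decomposable f \<longleftrightarrow>
    (\<forall>fs. And fs \<in> subfms f \<longrightarrow> sorted_wrt (\<lambda>f g. atoms f \<inter> atoms g = {}) fs)"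
  by (simp add: decomposable_def sorted_wrt_iff_nth_less imp_conjL)

lemma decomposable_simps [simp]:
  "decomposable (Atom a)"
  "decomposable (Neg f) \<longleftrightarrow> decomposable f"
  "decomposable (And fs) \<longleftrightarrow>
    sorted_wrt (\<lambda>f g. atoms f \<inter> atoms g = {}) fs \<and> (\<forall>f\<in>set fs. decomposable f)"
  "decomposable (Or fs) \<longleftrightarrow> (\<forall>f\<in>set fs. decomposable f)"
  by (auto simp: decomposable_iff_sorted_wrt)

lemma deterministic_iff_sorted_wrt:
  "deterministic f \<longleftrightarrow> (\<forall>fs. Or fs \<in> subfms f \<longrightarrow> sorted_wrt prop_inconsistent fs)"
  by (simp add: deterministic_def sorted_wrt_iff_nth_less imp_conjL)

lemma deterministic_simps [simp]:
  "deterministic (Atom a)"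
  "deterministic (Neg f) \<longleftrightarrow> deterministic f"
  "deterministic (And fs) \<longleftrightarrow> (\<forall>f\<in>set fs. deterministic f)"
  "deterministic (Or fs) \<longleftrightarrow>
    sorted_wrt prop_inconsistent fs \<and> (\<forall>f\<in>set fs. deterministic f)"
  by (auto simp: deterministic_iff_sorted_wrt)

lemma decomposable_abstraction: "decomposable (abstraction f) \<longleftrightarrow> decomposable f"
proof (induction f)
  case (And fs)
  have "BVar ` A \<inter> BVar ` B = {} \<longleftrightarrow> A \<inter> B = {}" for A B :: "'a set"
    by auto
  with And show ?case by (simp add: abstraction_def sorted_wrt_map fm.set_map)
qed (simp_all add: abstraction_def)

lemma deterministic_abstraction: "deterministic (abstraction f) \<longleftrightarrow> deterministic f"
  unfolding abstraction_def
  by (induction f)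
    (simp_all add: sorted_wrt_map prop_inconsistent_abstraction[unfolded abstraction_def])

section \<open>Weighted model counting\<close>

text \<open>
  \<open>pol a\<close> tells whether the literals \<open>a\<close> and \<open>\<not> a\<close> are imposed; atoms with neither are free and
  decided by membership in \<open>S\<close>.
\<close>

definition completion :: "('a \<Rightarrow> bool \<times> bool) \<Rightarrow> 'a set \<Rightarrow> 'a \<Rightarrow> bool" where
  "completion pol S a \<longleftrightarrow> fst (pol a) \<or> \<not> snd (pol a) \<and> a \<in> S"

definition models :: "('a \<Rightarrow> bool \<times> bool) \<Rightarrow> 'a set \<Rightarrow> 'a fm \<Rightarrow> 'a set set" where
  "models pol A f = {S. S \<subseteq> A \<and> holds (completion pol S) f}"

text \<open>The probability of \<open>f\<close> in units of \<open>1/2\<^sup>n\<close>.\<close>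

definition wmc :: "nat \<Rightarrow> 'a set \<Rightarrow> ('a \<Rightarrow> bool \<times> bool) \<Rightarrow> 'a fm \<Rightarrow> nat" where
  "wmc n A pol f = 2 ^ (n - card A) * card (models pol A f)"

lemma models_subset_Pow: "models pol A f \<subseteq> Pow A"
  by (auto simp: models_def)

lemma finite_models: "finite A \<Longrightarrow> finite (models pol A f)"
  by (metis finite_Pow_iff finite_subset models_subset_Pow)

lemma wmc_Or_Nil: "wmc n A pol (Or []) = 0"
  by (simp add: wmc_def models_def)

text \<open>
  Swapping the parts outside \<open>B\<close> of two subsets turns a model of both predicates and an arbitrary
  subset into a model of each.
\<close>

lemma card_Collect_independent:
  assumes "finite A"
    and p_inside: "\<And>S S'. S \<inter> B = S' \<inter> B \<Longrightarrow> p S = p S'"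
    and q_outside: "\<And>S S'. S - B = S' - B \<Longrightarrow> q S = q S'"
  shows "card {S. S \<subseteq> A \<and> p S} * card {S. S \<subseteq> A \<and> q S} =
    2 ^ card A * card {S. S \<subseteq> A \<and> p S \<and> q S}"
proof -
  define swap where "swap = (\<lambda>(S, S'). (S \<inter> B \<union> (S' - B), S' \<inter> B \<union> (S - B)))"
  let ?L = "{S. S \<subseteq> A \<and> p S} \<times> {S. S \<subseteq> A \<and> q S}"
  let ?R = "{S. S \<subseteq> A \<and> p S \<and> q S} \<times> Pow A"
  have swapped: "p (S \<inter> B \<union> (S' - B)) = p S" "q (S \<inter> B \<union> (S' - B)) = q S'" for S S'
    by (rule p_inside, blast) (rule q_outside, blast)
  have involution: "swap (swap x) = x" for x by (cases x) (auto simp: swap_def)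
  have "bij_betw swap ?L ?R"
  proof (rule bij_betw_byWitness[where f' = swap])
    show "swap ` ?L \<subseteq> ?R" "swap ` ?R \<subseteq> ?L" by (auto simp: swap_def swapped)
  qed (simp_all add: involution)
  then have "card ?L = card ?R" by (rule bij_betw_same_card)
  then show ?thesis using assms(1) by (simp add: card_cartesian_product card_Pow)
qed

lemma card_Pow_containing:
  assumes "finite A" "a \<in> A"
  shows "card {S. S \<subseteq> A \<and> a \<in> S} = 2 ^ (card A - 1)"
proof -
  have "{S. S \<subseteq> A \<and> a \<in> S} = insert a ` Pow (A - {a})"
  proof -
    have "S = insert a (S - {a})" if "a \<in> S" for S using that by blast
    then show ?thesis using assms(2) by blast
  qed
  moreover have "inj_on (insert a) (Pow (A - {a}))"
    by (auto intro!: inj_onI)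
  ultimately show ?thesis using assms by (simp add: card_image card_Pow)
qed

context
  fixes A :: "'a set" and n :: nat and pol :: "'a \<Rightarrow> bool \<times> bool"
  assumes finite_A: "finite A" and card_A: "card A \<le> n"
begin

lemma pow2_split: "(2::nat) ^ n = 2 ^ (n - card A) * 2 ^ card A"
  using card_A by (simp flip: power_add)

lemma wmc_le: "wmc n A pol f \<le> 2 ^ n"
  unfolding wmc_def pow2_split using finite_A
  by (metis card_Pow card_mono finite_Pow_iff models_subset_Pow mult_le_mono2)

lemma wmc_eq_pow2_iff: "wmc n A pol f = 2 ^ n \<longleftrightarrow> (\<forall>S\<subseteq>A. holds (completion pol S) f)"
proof -
  have "wmc n A pol f = 2 ^ n \<longleftrightarrow> card (models pol A f) = card (Pow A)"
    unfolding wmc_def pow2_split using finite_A by (simp add: card_Pow)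
  also have "\<dots> \<longleftrightarrow> models pol A f = Pow A"
    using finite_A by (metis card_subset_eq finite_Pow_iff models_subset_Pow)
  finally show ?thesis by (auto simp: models_def)
qed

lemma wmc_Atom:
  assumes "a \<in> A"
  shows "wmc n A pol (Atom a) =
    (if fst (pol a) then 2 ^ n else if snd (pol a) then 0 else 2 ^ (n - 1))"
proof -
  have "0 < card A" using assms finite_A card_gt_0_iff by blast
  then have "(n - card A) + (card A - 1) = n - 1" using card_A by simp
  then have "2 ^ (n - card A) * card {S. S \<subseteq> A \<and> a \<in> S} = 2 ^ (n - 1)"
    unfolding card_Pow_containing[OF finite_A assms] by (metis power_add)
  moreover have "wmc n A pol (Atom a) = 2 ^ n" if "fst (pol a)"
    using that by (simp add: wmc_eq_pow2_iff completion_def)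
  ultimately show ?thesis by (simp add: wmc_def models_def completion_def)
qed

lemma wmc_Neg: "wmc n A pol (Neg f) = 2 ^ n - wmc n A pol f"
proof -
  have "models pol A f \<inter> models pol A (Neg f) = {}" "models pol A f \<union> models pol A (Neg f) = Pow A"
    by (auto simp: models_def)
  then have "card (models pol A f) + card (models pol A (Neg f)) = 2 ^ card A"
    using finite_A by (metis card_Pow card_Un_disjoint finite_models)
  then have "wmc n A pol f + wmc n A pol (Neg f) = 2 ^ n"
    by (simp add: wmc_def pow2_split flip: distrib_left)
  then show ?thesis by simp
qed

lemma wmc_And_Nil: "wmc n A pol (And []) = 2 ^ n"
  by (simp add: wmc_eq_pow2_iff)

lemma wmc_And_Cons:
  assumes "\<forall>g\<in>set fs. atoms f \<inter> atoms g = {}"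
  shows "wmc n A pol f * wmc n A pol (And fs) = 2 ^ n * wmc n A pol (And (f # fs))"
proof -
  have f_inside: "holds (completion pol S) f = holds (completion pol S') f"
    if "S \<inter> atoms f = S' \<inter> atoms f" for S S'
    by (rule holds_cong) (use that in \<open>auto simp: completion_def\<close>)
  have fs_outside: "holds (completion pol S) (And fs) = holds (completion pol S') (And fs)"
    if "S - atoms f = S' - atoms f" for S S'
    by (rule holds_cong) (use that assms in \<open>auto simp: completion_def\<close>)
  have "card (models pol A f) * card (models pol A (And fs)) =
      2 ^ card A * card (models pol A (And (f # fs)))"
    using card_Collect_independent[OF finite_A f_inside fs_outside] by (simp add: models_def)
  then show ?thesis by (simp add: wmc_def pow2_split ac_simps)
qed

lemma wmc_Or_Cons:
  assumes "\<forall>g\<in>set fs. prop_inconsistent f g"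
  shows "wmc n A pol (Or (f # fs)) = wmc n A pol f + wmc n A pol (Or fs)"
proof -
  have "models pol A (Or (f # fs)) = models pol A f \<union> models pol A (Or fs)"
    by (auto simp: models_def)
  moreover have "models pol A f \<inter> models pol A (Or fs) = {}"
    using assms by (auto simp: models_def prop_inconsistent_def)
  ultimately show ?thesis
    by (simp add: wmc_def card_Un_disjoint finite_models finite_A distrib_left)
qed

end

section \<open>Fixed-point arithmetic\<close>

abbreviation bits_val :: "bool list \<Rightarrow> nat" where
  "bits_val \<equiv> horner_sum of_bool 2"

lemma bits_val_replicate_False: "bits_val (replicate k False) = 0"
  by (induction k) auto

lemma bits_val_tl: "bits_val (tl xs) = bits_val xs div 2"
  by (cases xs) auto

lemma bits_val_map_Not: "Suc (bits_val (map Not xs) + bits_val xs) = 2 ^ length xs"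
  by (induction xs) auto

lemma last_bit_iff:
  assumes "xs \<noteq> []"
  shows "last xs \<longleftrightarrow> 2 ^ (length xs - 1) \<le> bits_val xs"
proof -
  obtain ys b where xs: "xs = ys @ [b]" using assms by (metis append_butlast_last_id)
  show ?thesis
    using horner_sum_of_bool_2_less[of ys, where 'a = nat]
    by (cases b) (simp_all add: xs horner_sum_append)
qed

definition xor3 :: "bool \<Rightarrow> bool \<Rightarrow> bool \<Rightarrow> bool" where
  "xor3 a b c \<longleftrightarrow> (a = (b = c))"

definition maj3 :: "bool \<Rightarrow> bool \<Rightarrow> bool \<Rightarrow> bool" where
  "maj3 a b c \<longleftrightarrow> (if a then b \<or> c else b \<and> c)"

text \<open>\<open>c + y \<cdot> xs + zs\<close> for a carry \<open>c\<close> and a bit \<open>y\<close>, truncated to the width of \<open>xs\<close>.\<close>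

fun add_bits :: "bool \<Rightarrow> bool \<Rightarrow> bool list \<Rightarrow> bool list \<Rightarrow> bool list" where
  "add_bits c y [] zs = []"
| "add_bits c y (x # xs) zs =
     (let x' = y \<and> x; z = zs \<noteq> [] \<and> hd zs in xor3 c x' z # add_bits (maj3 c x' z) y xs (tl zs))"

lemma length_add_bits [simp]: "length (add_bits c y xs zs) = length xs"
  by (induction c y xs zs rule: add_bits.induct) (auto simp: Let_def)

lemma bits_val_add_bits:
  "bits_val (add_bits c y xs zs) =
    (of_bool c + of_bool y * bits_val xs + bits_val zs) mod 2 ^ length xs"
proof (induction c y xs zs rule: add_bits.induct)
  case (2 c y x xs zs)
  define z where "z = (zs \<noteq> [] \<and> hd zs)"
  define carry where
    "carry = of_bool (maj3 c (y \<and> x) z) + of_bool y * bits_val xs + bits_val (tl zs)"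
  have zs: "bits_val zs = of_bool z + 2 * bits_val (tl zs)"
    by (cases zs) (auto simp: z_def)
  have "of_bool c + of_bool y * bits_val (x # xs) + bits_val zs =
      of_bool (xor3 c (y \<and> x) z) + 2 * carry"
    unfolding zs carry_def by (cases c; cases y; cases x; cases z) (auto simp: xor3_def maj3_def)
  moreover have "(of_bool b + 2 * k) mod (2 * m) = of_bool b + 2 * (k mod m)"
    for b and k m :: nat
    by (cases b) (simp_all add: mod_mult2_eq)
  ultimately show ?case using 2 by (simp add: Let_def flip: z_def carry_def)
qed simp

text \<open>
  The accumulator is halved after each bit of the multiplier but the last, so for numbers of
  \<open>n + 1\<close> bits this is the product of fixed-point numbers with unit \<open>2\<^sup>n\<close>.
\<close>

fun mul_bits :: "bool list \<Rightarrow> bool list \<Rightarrow> bool list \<Rightarrow> bool list" where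
  "mul_bits acc xs [] = add_bits False False xs acc"
| "mul_bits acc xs [y] = add_bits False y xs acc"
| "mul_bits acc xs (y # y' # ys) = mul_bits (tl (add_bits False y xs acc)) xs (y' # ys)"

lemma length_mul_bits [simp]: "length (mul_bits acc xs ys) = length xs"
  by (induction acc xs ys rule: mul_bits.induct) auto

text \<open>
  Halving the accumulator after each bit discards low-order bits, but nested floor divisions
  compose, so the result is the exact quotient; the first bound rules out overflow.
\<close>

lemma bits_val_mul_bits:
  assumes "bits_val acc < bits_val xs \<or> bits_val acc = 0" "2 * bits_val xs \<le> 2 ^ length xs"
    and "ys \<noteq> []"
  shows "bits_val (mul_bits acc xs ys) =
    (bits_val acc + bits_val xs * bits_val ys) div 2 ^ (length ys - 1)"
  using assms
proof (induction acc xs ys rule: mul_bits.induct)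
  case (2 acc xs y)
  then have "of_bool y * bits_val xs + bits_val acc < 2 ^ length xs"
    using horner_sum_of_bool_2_less[of xs, where 'a = nat] by (cases y) auto
  then show ?case by (simp add: bits_val_add_bits algebra_simps)
next
  case (3 acc xs y y' ys)
  let ?X = "bits_val xs" and ?A = "bits_val acc" and ?Y = "bits_val (y' # ys)"
  let ?S = "(of_bool y * ?X + ?A) div 2"
  have "of_bool y * ?X + ?A < 2 ^ length xs"
    using 3 horner_sum_of_bool_2_less[of xs, where 'a = nat] by (cases y) auto
  then have halved: "bits_val (tl (add_bits False y xs acc)) = ?S"
    by (simp add: bits_val_add_bits bits_val_tl)
  have "?S < ?X \<or> ?S = 0"
    using 3 by (cases y) auto
  then have "bits_val (mul_bits acc xs (y # y' # ys)) =
      (?S + ?X * ?Y) div 2 ^ (length (y' # ys) - 1)"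
    using 3 halved by simp
  also have "?S + ?X * ?Y = (of_bool y * ?X + ?A + 2 * (?X * ?Y)) div 2"
    by simp
  also have "of_bool y * ?X + ?A + 2 * (?X * ?Y) = ?A + ?X * bits_val (y # y' # ys)"
    by (simp add: algebra_simps)
  finally show ?case by (simp only: div_mult2_eq[symmetric]) simp
qed simp

corollary bits_val_mul_bits_unit:
  assumes "length xs = Suc n" "length ys = Suc n" "bits_val xs \<le> 2 ^ n"
  shows "bits_val (mul_bits [] xs ys) = bits_val xs * bits_val ys div 2 ^ n"
proof -
  have "ys \<noteq> []" using assms(2) by auto
  then show ?thesis using assms by (simp add: bits_val_mul_bits)
qed

definition zero_bits :: "nat \<Rightarrow> bool list" where
  "zero_bits n = replicate n False @ [False]"

definition one_bits :: "nat \<Rightarrow> bool list" where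
  "one_bits n = replicate n False @ [True]"

definition half_bits :: "nat \<Rightarrow> bool list" where
  "half_bits n = replicate (n - 1) False @ [True, False]"

definition literal_bits :: "nat \<Rightarrow> bool \<times> bool \<Rightarrow> bool list" where
  "literal_bits n p = (if fst p then one_bits n else if snd p then zero_bits n else half_bits n)"

lemma length_const_bits [simp]:
  "length (zero_bits n) = Suc n"
  "length (one_bits n) = Suc n"
  "0 < n \<Longrightarrow> length (half_bits n) = Suc n"
  by (simp_all add: zero_bits_def one_bits_def half_bits_def)

lemma bits_val_const_bits [simp]:
  "bits_val (zero_bits n) = 0"
  "bits_val (one_bits n) = 2 ^ n"
  "bits_val (half_bits n) = 2 ^ (n - 1)"
  by (simp_all add: zero_bits_def one_bits_def half_bits_def horner_sum_append
      bits_val_replicate_False)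

text \<open>In two's complement, \<open>2\<^sup>n - x\<close> is the sum of \<open>2\<^sup>n\<close>, \<open>1\<close> and the inverted bits of \<open>x\<close>.\<close>

definition complement_bits :: "nat \<Rightarrow> bool list \<Rightarrow> bool list" where
  "complement_bits n xs = add_bits True True (map Not xs) (one_bits n)"

lemma bits_val_complement_bits:
  assumes "length xs = Suc n" "bits_val xs \<le> 2 ^ n"
  shows "bits_val (complement_bits n xs) = 2 ^ n - bits_val xs"
proof -
  have "bits_val (complement_bits n xs) = (1 + bits_val (map Not xs) + 2 ^ n) mod 2 ^ Suc n"
    using assms(1) by (simp add: complement_bits_def bits_val_add_bits)
  also have "1 + bits_val (map Not xs) + 2 ^ n = (2 ^ n - bits_val xs) + 2 ^ Suc n"
    using bits_val_map_Not[of xs] assms by simp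
  also have "((2 ^ n - bits_val xs) + 2 ^ Suc n) mod 2 ^ Suc n = 2 ^ n - bits_val xs"
    by (subst mod_add_self2) (simp add: less_imp_diff_less)
  finally show ?thesis .
qed

fun weight :: "nat \<Rightarrow> ('a \<Rightarrow> bool \<times> bool) \<Rightarrow> 'a fm \<Rightarrow> bool list" where
  "weight n pol (Atom a) = literal_bits n (pol a)"
| "weight n pol (Neg f) = complement_bits n (weight n pol f)"
| "weight n pol (And fs) = foldr (\<lambda>f. mul_bits [] (weight n pol f)) fs (one_bits n)"
| "weight n pol (Or fs) = foldr (\<lambda>f. add_bits False True (weight n pol f)) fs (zero_bits n)"

lemma length_weight: "0 < n \<Longrightarrow> length (weight n pol f) = Suc n"
  by (induction f rule: fm_cons_induct) (simp_all add: literal_bits_def complement_bits_def)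

lemma bits_val_weight:
  assumes A: "finite A" "card A \<le> n" and n: "0 < n"
  shows "decomposable f \<Longrightarrow> deterministic f \<Longrightarrow> atoms f \<subseteq> A \<Longrightarrow>
    bits_val (weight n pol f) = wmc n A pol f"
proof (induction f rule: fm_cons_induct)
  case (Atom a)
  then show ?case using wmc_Atom[OF A, of a pol] by (simp add: literal_bits_def)
next
  case (Neg f)
  then show ?case
    using wmc_le[OF A, of pol f] bits_val_complement_bits[OF length_weight[OF n, of pol f]]
    by (simp add: wmc_Neg[OF A])
next
  case And_Nil
  then show ?case using wmc_And_Nil[OF A] by simp
next
  case (And_Cons f fs)
  let ?w = "weight n pol f" and ?ws = "weight n pol (And fs)"
  have vals: "bits_val ?w = wmc n A pol f" "bits_val ?ws = wmc n A pol (And fs)"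
    using And_Cons by simp_all
  have "bits_val (mul_bits [] ?w ?ws) = bits_val ?w * bits_val ?ws div 2 ^ n"
    by (intro bits_val_mul_bits_unit length_weight[OF n]) (simp add: vals(1) wmc_le[OF A])
  also have "\<dots> = 2 ^ n * wmc n A pol (And (f # fs)) div 2 ^ n"
    using wmc_And_Cons[OF A, of fs f pol] And_Cons.prems unfolding vals by simp
  finally show ?case by simp
next
  case Or_Nil
  then show ?case by (simp add: wmc_Or_Nil)
next
  case (Or_Cons f fs)
  have "bits_val (weight n pol f) = wmc n A pol f"
      "bits_val (weight n pol (Or fs)) = wmc n A pol (Or fs)"
    using Or_Cons by simp_all
  moreover have "wmc n A pol (Or (f # fs)) = wmc n A pol f + wmc n A pol (Or fs)"
    using wmc_Or_Cons[OF A, of fs f pol] Or_Cons.prems by simp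
  moreover have "wmc n A pol (Or (f # fs)) < 2 ^ Suc n"
    using wmc_le[OF A, of pol "Or (f # fs)"] by (simp add: le_less_trans)
  ultimately show ?case
    using length_weight[OF n, of pol f] by (simp add: bits_val_add_bits)
qed

section \<open>Entailment by a cube\<close>

text \<open>Whether \<open>a\<close> occurs positively, and whether it occurs negatively.\<close>

fun polarity :: "'a \<Rightarrow> 'a fm \<Rightarrow> bool \<times> bool" where
  "polarity a (Atom b) = (b = a, False)"
| "polarity a (Neg f) = prod.swap (polarity a f)"
| "polarity a (And fs) = (\<exists>f\<in>set fs. fst (polarity a f), \<exists>f\<in>set fs. snd (polarity a f))"
| "polarity a (Or fs) = (\<exists>f\<in>set fs. fst (polarity a f), \<exists>f\<in>set fs. snd (polarity a f))"

lemma polarity_in_atoms: "fst (polarity a f) \<or> snd (polarity a f) \<Longrightarrow> a \<in> atoms f"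
  by (induction f) auto

lemma holds_literal_iff:
  "is_literal f \<Longrightarrow>
    holds v f \<longleftrightarrow> (\<forall>a. (fst (polarity a f) \<longrightarrow> v a) \<and> (snd (polarity a f) \<longrightarrow> \<not> v a))"
  by (auto simp: is_literal_def)

lemma holds_cube_iff:
  assumes "is_cube f"
  shows "holds v f \<longleftrightarrow> (\<forall>a. (fst (polarity a f) \<longrightarrow> v a) \<and> (snd (polarity a f) \<longrightarrow> \<not> v a))"
  using assms unfolding is_cube_def
proof
  assume "\<exists>ls. f = And ls \<and> (\<forall>l\<in>set ls. is_literal l)"
  then obtain ls where "f = And ls" "\<forall>l\<in>set ls. is_literal l" by blast
  then show ?thesis by (auto simp: holds_literal_iff)
qed (rule holds_literal_iff)

definition clashing :: "'a fm \<Rightarrow> 'a \<Rightarrow> bool" where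
  "clashing f a \<longleftrightarrow> fst (polarity a f) \<and> snd (polarity a f)"

lemma prop_entails_iff_completion:
  assumes "is_cube g" "\<nexists>a. clashing g a"
  shows "prop_entails g f \<longleftrightarrow> (\<forall>S\<subseteq>atoms f. holds (completion (\<lambda>a. polarity a g) S) f)"
    (is "_ \<longleftrightarrow> (\<forall>S\<subseteq>_. holds (?completion S) f)")
proof
  assume entails: "prop_entails g f"
  have "holds (?completion S) g" for S
    using assms(2) unfolding holds_cube_iff[OF assms(1)] completion_def clashing_def by blast
  then show "\<forall>S\<subseteq>atoms f. holds (?completion S) f"
    using entails unfolding prop_entails_def by blast
next
  assume all: "\<forall>S\<subseteq>atoms f. holds (?completion S) f"
  show "prop_entails g f" unfolding prop_entails_def
  proof (intro allI impI)
    fix v assume "holds v g"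
    then have "?completion {a \<in> atoms f. v a} a = v a" if "a \<in> atoms f" for a
      using that unfolding holds_cube_iff[OF assms(1)] by (auto simp: completion_def)
    then have "holds (?completion {a \<in> atoms f. v a}) f = holds v f"
      by (rule holds_cong)
    moreover have "holds (?completion {a \<in> atoms f. v a}) f"
      using all by (simp add: Collect_restrict)
    ultimately show "holds v f" by simp
  qed
qed

lemma prop_entails_iff_weight:
  assumes "decomposable f" "deterministic f" "finite (atoms f)" "card (atoms f) \<le> n" "0 < n"
    and "is_cube g"
  shows "prop_entails g f \<longleftrightarrow> (\<exists>a. clashing g a) \<or> last (weight n (\<lambda>a. polarity a g) f)"
proof (cases "\<exists>a. clashing g a")
  case True
  then have "prop_entails g f"
    unfolding prop_entails_def clashing_def holds_cube_iff[OF assms(6)] by blast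
  with True show ?thesis by blast
next
  case False
  let ?w = "weight n (\<lambda>a. polarity a g) f" and ?wmc = "wmc n (atoms f) (\<lambda>a. polarity a g) f"
  have "last ?w \<longleftrightarrow> 2 ^ n \<le> ?wmc"
    using last_bit_iff[of ?w] length_weight[OF assms(5)] bits_val_weight[OF assms(3-5,1,2)]
    by (metis diff_Suc_1 list.size(3) nat.distinct(1) order_refl)
  also have "\<dots> \<longleftrightarrow> ?wmc = 2 ^ n"
    using wmc_le[OF assms(3,4)] by (metis order_antisym_conv order_refl)
  also have "\<dots> \<longleftrightarrow> prop_entails g f"
    using False
    by (simp add: wmc_eq_pow2_iff[OF assms(3,4)] prop_entails_iff_completion[OF assms(6)])
  finally show ?thesis using False by blast
qed

section \<open>The formulas of a DAG\<close>

lemma dag_fms_Nil: "dag_fms [] = []"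
  by (simp add: dag_fms_def)

lemma dag_fms_snoc: "dag_fms (ns @ [x]) = dag_fms ns @ [node_fm (dag_fms ns) x]"
  by (simp add: dag_fms_def)

lemma length_dag_fms [simp]: "length (dag_fms ns) = length ns"
  by (induction ns rule: rev_induct) (simp_all add: dag_fms_Nil dag_fms_snoc)

lemma take_dag_fms: "take i (dag_fms ns) = dag_fms (take i ns)"
proof (induction ns rule: rev_induct)
  case (snoc x ns)
  then show ?case by (cases "i \<le> length ns") (auto simp: dag_fms_snoc)
qed (simp add: dag_fms_Nil)

lemma node_fm_cong:
  "(\<And>i. i \<in> set (children x) \<Longrightarrow> fs ! i = gs ! i) \<Longrightarrow> node_fm fs x = node_fm gs x"
  by (cases x) simp_all

lemma is_dag_child_less:
  "is_dag ns \<Longrightarrow> j < length ns \<Longrightarrow> i \<in> set (children (ns ! j)) \<Longrightarrow> i < j"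
  by (simp add: is_dag_def)

lemma nth_dag_fms:
  assumes "is_dag ns" "i < length ns"
  shows "dag_fms ns ! i = node_fm (dag_fms ns) (ns ! i)"
proof -
  have "dag_fms ns ! i = take (Suc i) (dag_fms ns) ! i" by simp
  also have "\<dots> = dag_fms (take i ns @ [ns ! i]) ! i"
    using assms(2) by (simp add: take_dag_fms take_Suc_conv_app_nth)
  also have "\<dots> = node_fm (take i (dag_fms ns)) (ns ! i)"
    using assms(2) by (simp add: dag_fms_snoc nth_append take_dag_fms)
  also have "\<dots> = node_fm (dag_fms ns) (ns ! i)"
    using is_dag_child_less[OF assms] by (intro node_fm_cong) simp
  finally show ?thesis .
qed

lemma dag_fm_nth: "ns \<noteq> [] \<Longrightarrow> dag_fm ns = dag_fms ns ! (length ns - 1)"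
  by (metis dag_fm_def last_conv_nth length_0_conv length_dag_fms)

lemma atoms_node_fm:
  "atoms (node_fm fs x) = {a. x = NAtom a} \<union> (\<Union>i\<in>set (children x). atoms (fs ! i))"
  by (cases x) auto

lemma atoms_dag_fms_subset_nodes:
  "is_dag ns \<Longrightarrow> i < length ns \<Longrightarrow> atoms (dag_fms ns ! i) \<subseteq> {a. NAtom a \<in> set ns}"
proof (induction i rule: less_induct)
  case (less i)
  have "atoms (dag_fms ns ! j) \<subseteq> {a. NAtom a \<in> set ns}" if "j \<in> set (children (ns ! i))" for j
    using less is_dag_child_less[OF less.prems that] by simp
  moreover have "NAtom a \<in> set ns" if "ns ! i = NAtom a" for a
    using that less.prems(2) by (metis nth_mem)
  ultimately show ?case
    using less.prems by (auto simp: nth_dag_fms[OF less.prems] atoms_node_fm)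
qed

lemma atoms_dag_fms_subset_root:
  assumes "is_dag ns" "i < length ns"
  shows "atoms (dag_fms ns ! i) \<subseteq> atoms (dag_fm ns)"
  using assms(2)
proof (induction "length ns - i" arbitrary: i rule: less_induct)
  case less
  show ?case
  proof (cases "Suc i < length ns")
    case True
    then obtain j where j: "j < length ns" "i \<in> set (children (ns ! j))"
      using assms(1) by (auto simp: is_dag_def)
    have "atoms (dag_fms ns ! i) \<subseteq> atoms (dag_fms ns ! j)"
      using j(2) by (auto simp: nth_dag_fms[OF assms(1) j(1)] atoms_node_fm)
    also have "\<dots> \<subseteq> atoms (dag_fm ns)"
      using less j is_dag_child_less[OF assms(1) j] by simp
    finally show ?thesis .
  next
    case False
    then have "i = length ns - 1" "ns \<noteq> []" using less.prems by auto
    then show ?thesis by (simp add: dag_fm_nth)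
  qed
qed

lemma atoms_dag_fm:
  assumes "is_dag ns"
  shows "atoms (dag_fm ns) = {a. NAtom a \<in> set ns}"
proof
  have "ns \<noteq> []" using assms by (simp add: is_dag_def)
  then show "atoms (dag_fm ns) \<subseteq> {a. NAtom a \<in> set ns}"
    using atoms_dag_fms_subset_nodes[OF assms] by (simp add: dag_fm_nth)
  have "a \<in> atoms (dag_fm ns)" if "i < length ns" "ns ! i = NAtom a" for a i
    using atoms_dag_fms_subset_root[OF assms that(1)] nth_dag_fms[OF assms that(1)] that(2) by simp
  then show "{a. NAtom a \<in> set ns} \<subseteq> atoms (dag_fm ns)"
    by (auto simp: in_set_conv_nth)
qed

lemma finite_atoms: "finite (atoms f)"
  by (induction f) auto

lemma card_atoms_dag_fm_le:
  assumes "is_dag ns"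
  shows "card (atoms (dag_fm ns)) \<le> length ns"
proof -
  have "card (atoms (dag_fm ns)) \<le> card (set ns)"
    using assms by (intro card_inj_on_le[of NAtom]) (auto simp: inj_on_def atoms_dag_fm)
  also have "\<dots> \<le> length ns" by (rule card_length)
  finally show ?thesis .
qed

lemma length_children_le:
  assumes "is_dag ns" "x \<in> set ns"
  shows "length (children x) \<le> length ns"
proof -
  obtain i where i: "i < length ns" "x = ns ! i" using assms(2) by (auto simp: in_set_conv_nth)
  then have "distinct (children x)" "set (children x) \<subseteq> {..<i}"
    using assms(1) by (auto simp: is_dag_def)
  then have "length (children x) \<le> i"
    by (metis card_lessThan card_mono distinct_card finite_lessThan)
  then show ?thesis using i(1) by simp
qed

section \<open>Evaluation with a time bound\<close>

definition runs :: "program \<Rightarrow> tree list \<Rightarrow> expr \<Rightarrow> tree \<Rightarrow> nat \<Rightarrow> bool" where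
  "runs P env e u n \<longleftrightarrow> (\<exists>k\<le>n. eval P env e u k)"

definition runs_list :: "program \<Rightarrow> tree list \<Rightarrow> expr list \<Rightarrow> tree list \<Rightarrow> nat \<Rightarrow> bool" where
  "runs_list P env es us n \<longleftrightarrow> (\<exists>k\<le>n. evals P env es us k)"

definition call :: "program \<Rightarrow> nat \<Rightarrow> tree list \<Rightarrow> tree \<Rightarrow> nat \<Rightarrow> bool" where
  "call P g us w n \<longleftrightarrow> g < length P \<and> runs P us (P ! g) w n"

lemma runs_weaken: "runs P env e u k \<Longrightarrow> u = v \<Longrightarrow> k \<le> n \<Longrightarrow> runs P env e v n"
  by (auto simp: runs_def intro: order_trans)

lemma call_weaken: "call P g us u k \<Longrightarrow> u = v \<Longrightarrow> k \<le> n \<Longrightarrow> call P g us v n"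
  by (auto simp: call_def intro: runs_weaken)

lemma runs_Arg: "i < length env \<Longrightarrow> runs P env (Arg i) (env ! i) 1"
  unfolding runs_def using eval_Arg by blast

lemma runs_Args:
  "runs P (u # env) (Arg 0) u 1"
  "runs P (u # v # env) (Arg 1) v 1"
  "runs P (u # v # w # env) (Arg 2) w 1"
  "runs P (u # v # w # x # env) (Arg 3) x 1"
  using runs_Arg[of 0 "u # env"] runs_Arg[of 1 "u # v # env"] runs_Arg[of 2 "u # v # w # env"]
    runs_Arg[of 3 "u # v # w # x # env"] by simp_all

lemma runs_Lf: "runs P env ELf Lf 1"
  unfolding runs_def using eval_Lf by blast

lemma runs_Br:
  "runs P env e u k \<Longrightarrow> runs P env e' u' k' \<Longrightarrow> runs P env (EBr e e') (Br u u') (Suc (k + k'))"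
  unfolding runs_def by (metis Suc_le_mono add_mono eval_Br)

lemma runs_Left: "runs P env e u k \<Longrightarrow> left u = w \<Longrightarrow> runs P env (ELeft e) w (Suc k)"
  unfolding runs_def by (metis Suc_le_mono eval_Left)

lemma runs_Right: "runs P env e u k \<Longrightarrow> right u = w \<Longrightarrow> runs P env (ERight e) w (Suc k)"
  unfolding runs_def by (metis Suc_le_mono eval_Right)

lemma runs_If:
  assumes "runs P env e u k" "runs P env (if u = Lf then e2 else e1) w k'"
  shows "runs P env (EIf e e1 e2) w (Suc (k + k'))"
proof -
  obtain j j' where evals: "eval P env e u j" "eval P env (if u = Lf then e2 else e1) w j'"
    and le: "j \<le> k" "j' \<le> k'"
    using assms by (auto simp: runs_def)
  have "eval P env (EIf e e1 e2) w (Suc (j + j'))"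
    using evals by (cases "u = Lf") (auto intro: eval_If_Br eval_If_Lf)
  then show ?thesis using le unfolding runs_def by (metis Suc_le_mono add_mono)
qed

lemma runs_if_branches:
  "runs P env e2 w k \<Longrightarrow> runs P env (if Lf = Lf then e2 else e1) w k"
  "runs P env e1 w k \<Longrightarrow> runs P env (if Br u v = Lf then e2 else e1) w k"
  by simp_all

lemma runs_Call:
  "runs_list P env es us k \<Longrightarrow> call P g us w k' \<Longrightarrow> runs P env (ECall g es) w (Suc (k + k'))"
  unfolding runs_def runs_list_def call_def by (metis Suc_le_mono add_mono eval_Call)

lemma runs_Nil: "runs_list P env [] [] 0"
  unfolding runs_list_def using evals_Nil by blast

lemma runs_Cons:
  "runs P env e u k \<Longrightarrow> runs_list P env es us k' \<Longrightarrow> runs_list P env (e # es) (u # us) (k + k')"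
  unfolding runs_def runs_list_def by (metis add_mono evals_Cons)

lemmas runs_intros = runs_Args runs_Lf runs_Br runs_Left runs_Right runs_If runs_if_branches
  runs_Call runs_Nil runs_Cons left.simps right.simps

section \<open>The program\<close>

text \<open>Index \<open>0\<close> is left to the main function, indices 20--23 and 33--36 to evaluators.\<close>

abbreviation (input) "entails_fn \<equiv> 1 :: nat"
abbreviation (input) "last_fn \<equiv> 2 :: nat"
abbreviation (input) "nth_fn \<equiv> 3 :: nat"
abbreviation (input) "snoc_fn \<equiv> 4 :: nat"
abbreviation (input) "eq_fn \<equiv> 5 :: nat"
abbreviation (input) "not_fn \<equiv> 6 :: nat"
abbreviation (input) "or_fn \<equiv> 7 :: nat"
abbreviation (input) "and_fn \<equiv> 8 :: nat"
abbreviation (input) "xor_fn \<equiv> 9 :: nat"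
abbreviation (input) "maj_fn \<equiv> 10 :: nat"
abbreviation (input) "add_fn \<equiv> 11 :: nat"
abbreviation (input) "mul_fn \<equiv> 12 :: nat"
abbreviation (input) "pad_fn \<equiv> 13 :: nat"
abbreviation (input) "invert_fn \<equiv> 14 :: nat"
abbreviation (input) "polarity_atom_fn \<equiv> 15 :: nat"
abbreviation (input) "polarity_neg_fn \<equiv> 16 :: nat"
abbreviation (input) "polarity_join_fn \<equiv> 17 :: nat"
abbreviation (input) "polarity_none_fn \<equiv> 18 :: nat"
abbreviation (input) "polarity_fn \<equiv> 19 :: nat"
abbreviation (input) "clash_fn \<equiv> 24 :: nat"
abbreviation (input) "literal_fn \<equiv> 25 :: nat"
abbreviation (input) "weight_atom_fn \<equiv> 26 :: nat"
abbreviation (input) "weight_neg_fn \<equiv> 27 :: nat"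
abbreviation (input) "times_fn \<equiv> 28 :: nat"
abbreviation (input) "one_fn \<equiv> 29 :: nat"
abbreviation (input) "plus_fn \<equiv> 30 :: nat"
abbreviation (input) "zero_fn \<equiv> 31 :: nat"
abbreviation (input) "weight_fn \<equiv> 32 :: nat"

abbreviation ETrue :: expr where "ETrue \<equiv> EBr ELf ELf"

definition last_body :: expr where
  "last_body = EIf (ERight (Arg 0)) (ECall last_fn [ERight (Arg 0)]) (ELeft (Arg 0))"

definition nth_body :: expr where
  "nth_body = EIf (Arg 1) (ECall nth_fn [ERight (Arg 0), ERight (Arg 1)]) (ELeft (Arg 0))"

definition snoc_body :: expr where
  "snoc_body = EIf (Arg 0)
     (EBr (ELeft (Arg 0)) (ECall snoc_fn [ERight (Arg 0), Arg 1]))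
     (EBr (Arg 1) ELf)"

definition eq_body :: expr where
  "eq_body = EIf (Arg 0)
     (EIf (Arg 1) (ECall eq_fn [ERight (Arg 0), ERight (Arg 1)]) ELf)
     (EIf (Arg 1) ELf ETrue)"

definition not_body :: expr where
  "not_body = EIf (Arg 0) ELf ETrue"

definition or_body :: expr where
  "or_body = EIf (Arg 0) ETrue (Arg 1)"

definition and_body :: expr where
  "and_body = EIf (Arg 0) (Arg 1) ELf"

definition xor_body :: expr where
  "xor_body = EIf (Arg 0)
     (EIf (Arg 1) (Arg 2) (ECall not_fn [Arg 2]))
     (EIf (Arg 1) (ECall not_fn [Arg 2]) (Arg 2))"

definition maj_body :: expr where
  "maj_body = EIf (Arg 0) (ECall or_fn [Arg 1, Arg 2]) (ECall and_fn [Arg 1, Arg 2])"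

definition add_body :: expr where
  "add_body = (let x = ECall and_fn [Arg 1, ELeft (Arg 2)]; z = ELeft (Arg 3) in
     EIf (Arg 2)
       (EBr (ECall xor_fn [Arg 0, x, z])
         (ECall add_fn [ECall maj_fn [Arg 0, x, z], Arg 1, ERight (Arg 2), ERight (Arg 3)]))
       ELf)"

definition mul_body :: expr where
  "mul_body = (let sum = ECall add_fn [ELf, ELeft (Arg 2), Arg 1, Arg 0] in
     EIf (ERight (Arg 2)) (ECall mul_fn [ERight sum, Arg 1, ERight (Arg 2)]) sum)"

definition pad_body :: expr where
  "pad_body = EIf (Arg 0) (EBr ELf (ECall pad_fn [ERight (Arg 0), Arg 1])) (Arg 1)"

definition invert_body :: expr where
  "invert_body = EIf (Arg 0)
     (EBr (ECall not_fn [ELeft (Arg 0)]) (ECall invert_fn [ERight (Arg 0)]))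
     ELf"

text \<open>
  An evaluator occupies five functions from index \<open>b\<close> on and computes values of the formulas of a
  DAG from its leaves up, given functions that compute the value of a formula from those of its
  immediate subformulas. \<open>and_cons\<close> and \<open>or_cons\<close> add one child to a conjunction or disjunction.
  The last argument is a parameter that is handed through to \<open>atom\<close>, \<open>neg\<close>, \<open>and_nil\<close> and \<open>or_nil\<close>.
\<close>

definition fold_body :: "nat \<Rightarrow> nat \<Rightarrow> nat \<Rightarrow> expr" where
  "fold_body self comb unit = EIf (Arg 0)
     (ECall comb
       [ECall nth_fn [Arg 1, ELeft (Arg 0)], ECall self [ERight (Arg 0), Arg 1, Arg 2]])
     (ECall unit [Arg 2])"

definition node_body :: "nat \<Rightarrow> nat \<Rightarrow> nat \<Rightarrow> nat \<Rightarrow> expr" where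
  "node_body atom neg and_fold or_fold =
     (let tag = ELeft (Arg 0); content = ERight (Arg 0) in
      EIf tag
        (EIf (ERight tag)
          (EIf (ERight (ERight tag))
            (ECall or_fold [content, Arg 1, Arg 2])
            (ECall and_fold [content, Arg 1, Arg 2]))
          (ECall neg [ECall nth_fn [Arg 1, content], Arg 2]))
        (ECall atom [content, Arg 2]))"

definition table_body :: "nat \<Rightarrow> nat \<Rightarrow> expr" where
  "table_body self node = EIf (Arg 0)
     (ECall self [ERight (Arg 0),
       ECall snoc_fn [Arg 1, ECall node [ELeft (Arg 0), Arg 1, Arg 2]], Arg 2])
     (Arg 1)"

definition root_body :: "nat \<Rightarrow> expr" where
  "root_body table = ECall last_fn [ECall table [Arg 0, ELf, Arg 1]]"

definition evaluator :: "nat \<Rightarrow> nat \<Rightarrow> nat \<Rightarrow> nat \<Rightarrow> nat \<Rightarrow> nat \<Rightarrow> nat \<Rightarrow> expr list" where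
  "evaluator b atom neg and_cons and_nil or_cons or_nil =
     [root_body (b + 1), table_body (b + 1) (b + 2), node_body atom neg (b + 3) (b + 4),
      fold_body (b + 3) and_cons and_nil, fold_body (b + 4) or_cons or_nil]"

definition polarity_atom_body :: expr where
  "polarity_atom_body = EBr (ECall eq_fn [Arg 0, Arg 1]) ELf"

definition polarity_neg_body :: expr where
  "polarity_neg_body = EBr (ERight (Arg 0)) (ELeft (Arg 0))"

definition polarity_join_body :: expr where
  "polarity_join_body = EBr (ECall or_fn [ELeft (Arg 0), ELeft (Arg 1)])
     (ECall or_fn [ERight (Arg 0), ERight (Arg 1)])"

definition polarity_none_body :: expr where
  "polarity_none_body = EBr ELf ELf"

definition clash_body :: expr where
  "clash_body =
     (let node = ELeft (Arg 0); rest = ECall clash_fn [ERight (Arg 0), Arg 1];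
        p = ECall polarity_fn [Arg 1, ERight node] in
      EIf (Arg 0)
        (EIf (ELeft node) rest (ECall or_fn [ECall and_fn [ELeft p, ERight p], rest]))
        ELf)"

definition literal_body :: expr where
  "literal_body = EIf (ELeft (Arg 0)) (ECall pad_fn [Arg 1, EBr ETrue ELf])
     (EIf (ERight (Arg 0)) (ECall pad_fn [Arg 1, EBr ELf ELf])
       (ECall pad_fn [ERight (Arg 1), EBr ETrue (EBr ELf ELf)]))"

definition weight_atom_body :: expr where
  "weight_atom_body =
     ECall literal_fn [ECall polarity_fn [ERight (Arg 1), Arg 0], ELeft (Arg 1)]"

definition weight_neg_body :: expr where
  "weight_neg_body =
     ECall add_fn [ETrue, ETrue, ECall invert_fn [Arg 0], ECall one_fn [Arg 1]]"

definition times_body :: expr where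
  "times_body = ECall mul_fn [ELf, Arg 0, Arg 1]"

definition one_body :: expr where
  "one_body = ECall pad_fn [ELeft (Arg 0), EBr ETrue ELf]"

definition plus_body :: expr where
  "plus_body = ECall add_fn [ELf, ETrue, Arg 0, Arg 1]"

definition zero_body :: expr where
  "zero_body = ECall pad_fn [ELeft (Arg 0), EBr ELf ELf]"

definition entails_body :: expr where
  "entails_body = ECall or_fn [ECall clash_fn [Arg 1, Arg 1],
     ECall last_fn [ECall weight_fn [Arg 0, EBr (Arg 0) (Arg 1)]]]"

definition prog :: "expr \<Rightarrow> program" where
  "prog main =
     [main, entails_body, last_body, nth_body, snoc_body, eq_body, not_body, or_body, and_body,
      xor_body, maj_body, add_body, mul_body, pad_body, invert_body,
      polarity_atom_body, polarity_neg_body, polarity_join_body, polarity_none_body] @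
     evaluator polarity_fn polarity_atom_fn polarity_neg_fn polarity_join_fn polarity_none_fn
       polarity_join_fn polarity_none_fn @
     [clash_body, literal_body, weight_atom_body, weight_neg_body, times_body, one_body, plus_body,
      zero_body] @
     evaluator weight_fn weight_atom_fn weight_neg_fn times_fn one_fn plus_fn zero_fn"

lemma call_prog:
  "call (prog main) entails_fn us w n \<longleftrightarrow> runs (prog main) us entails_body w n"
  "call (prog main) last_fn us w n \<longleftrightarrow> runs (prog main) us last_body w n"
  "call (prog main) nth_fn us w n \<longleftrightarrow> runs (prog main) us nth_body w n"
  "call (prog main) snoc_fn us w n \<longleftrightarrow> runs (prog main) us snoc_body w n"
  "call (prog main) eq_fn us w n \<longleftrightarrow> runs (prog main) us eq_body w n"
  "call (prog main) not_fn us w n \<longleftrightarrow> runs (prog main) us not_body w n"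
  "call (prog main) or_fn us w n \<longleftrightarrow> runs (prog main) us or_body w n"
  "call (prog main) and_fn us w n \<longleftrightarrow> runs (prog main) us and_body w n"
  "call (prog main) xor_fn us w n \<longleftrightarrow> runs (prog main) us xor_body w n"
  "call (prog main) maj_fn us w n \<longleftrightarrow> runs (prog main) us maj_body w n"
  "call (prog main) add_fn us w n \<longleftrightarrow> runs (prog main) us add_body w n"
  "call (prog main) mul_fn us w n \<longleftrightarrow> runs (prog main) us mul_body w n"
  "call (prog main) pad_fn us w n \<longleftrightarrow> runs (prog main) us pad_body w n"
  "call (prog main) invert_fn us w n \<longleftrightarrow> runs (prog main) us invert_body w n"
  "call (prog main) polarity_atom_fn us w n \<longleftrightarrow> runs (prog main) us polarity_atom_body w n"
  "call (prog main) polarity_neg_fn us w n \<longleftrightarrow> runs (prog main) us polarity_neg_body w n"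
  "call (prog main) polarity_join_fn us w n \<longleftrightarrow> runs (prog main) us polarity_join_body w n"
  "call (prog main) polarity_none_fn us w n \<longleftrightarrow> runs (prog main) us polarity_none_body w n"
  "call (prog main) clash_fn us w n \<longleftrightarrow> runs (prog main) us clash_body w n"
  "call (prog main) literal_fn us w n \<longleftrightarrow> runs (prog main) us literal_body w n"
  "call (prog main) weight_atom_fn us w n \<longleftrightarrow> runs (prog main) us weight_atom_body w n"
  "call (prog main) weight_neg_fn us w n \<longleftrightarrow> runs (prog main) us weight_neg_body w n"
  "call (prog main) times_fn us w n \<longleftrightarrow> runs (prog main) us times_body w n"
  "call (prog main) one_fn us w n \<longleftrightarrow> runs (prog main) us one_body w n"
  "call (prog main) plus_fn us w n \<longleftrightarrow> runs (prog main) us plus_body w n"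
  "call (prog main) zero_fn us w n \<longleftrightarrow> runs (prog main) us zero_body w n"
  unfolding call_def by (simp_all add: prog_def evaluator_def)

lemma prog_evaluators:
  "take 5 (drop polarity_fn (prog main)) =
    evaluator polarity_fn polarity_atom_fn polarity_neg_fn polarity_join_fn polarity_none_fn
      polarity_join_fn polarity_none_fn"
  "take 5 (drop weight_fn (prog main)) =
    evaluator weight_fn weight_atom_fn weight_neg_fn times_fn one_fn plus_fn zero_fn"
  by (simp_all add: prog_def evaluator_def)

section \<open>Lists, bits and arithmetic\<close>

definition enc_bool :: "bool \<Rightarrow> tree" where
  "enc_bool b = (if b then Br Lf Lf else Lf)"

definition enc_bits :: "bool list \<Rightarrow> tree" where
  "enc_bits xs = enc_list (map enc_bool xs)"

lemma enc_bool_simps [simp]: "enc_bool True = Br Lf Lf" "enc_bool False = Lf"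
  by (simp_all add: enc_bool_def)

lemma enc_list_simps [simp]: "enc_list [] = Lf" "enc_list (u # us) = Br u (enc_list us)"
  by (simp_all add: enc_list_def)

lemma enc_bits_simps [simp]: "enc_bits [] = Lf" "enc_bits (x # xs) = Br (enc_bool x) (enc_bits xs)"
  by (simp_all add: enc_bits_def)

lemma left_enc_bits: "left (enc_bits xs) = enc_bool (xs \<noteq> [] \<and> hd xs)"
  by (cases xs) simp_all

lemma right_enc_bits: "right (enc_bits xs) = enc_bits (tl xs)"
  by (cases xs) simp_all

lemma call_last: "us \<noteq> [] \<Longrightarrow> call (prog main) last_fn [enc_list us] (last us) (10 * length us)"
proof (induction us)
  case (Cons u us)
  show ?case
  proof (cases us)
    case Nil
    show ?thesis unfolding Nil enc_list_simps call_prog last_body_def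
      by (rule runs_weaken, (rule runs_intros)+) simp_all
  next
    case (Cons v vs)
    have rest: "call (prog main) last_fn [Br v (enc_list vs)] (last us) (10 * length us)"
      using Cons.IH Cons by simp
    show ?thesis unfolding Cons enc_list_simps call_prog last_body_def
      by (rule runs_weaken, (rule runs_intros rest)+) (simp_all add: Cons)
  qed
qed simp

lemma call_nth:
  "i < length us \<Longrightarrow> call (prog main) nth_fn [enc_list us, enc_nat i] (us ! i) (10 * Suc i)"
proof (induction us arbitrary: i)
  case (Cons u us)
  show ?case
  proof (cases i)
    case 0
    show ?thesis unfolding 0 enc_list_simps enc_nat.simps call_prog nth_body_def
      by (rule runs_weaken, (rule runs_intros)+) simp_all
  next
    case (Suc j)
    then have rest: "call (prog main) nth_fn [enc_list us, enc_nat j] (us ! j) (10 * Suc j)"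
      using Cons by simp
    show ?thesis unfolding Suc enc_list_simps enc_nat.simps call_prog nth_body_def
      by (rule runs_weaken, (rule runs_intros rest)+) simp_all
  qed
qed simp

lemma call_nth_map:
  assumes "i < length xs" "length xs \<le> M"
  shows "call (prog main) nth_fn [enc_list (map r xs), enc_nat i] (r (xs ! i)) (10 * M)"
  by (rule call_weaken[OF call_nth]) (use assms in auto)

lemma call_snoc:
  "call (prog main) snoc_fn [enc_list us, v] (enc_list (us @ [v])) (10 * Suc (length us))"
proof (induction us)
  case Nil
  show ?case unfolding enc_list_simps call_prog snoc_body_def
    by (rule runs_weaken, (rule runs_intros)+) simp_all
next
  case (Cons u us)
  show ?case unfolding enc_list_simps call_prog snoc_body_def
    by (rule runs_weaken, (rule runs_intros Cons.IH)+) simp_all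
qed

lemma call_eq: "call (prog main) eq_fn [enc_nat i, enc_nat j] (enc_bool (i = j)) (10 * Suc j)"
proof (induction i arbitrary: j)
  case 0
  show ?case
    by (cases j; simp only: enc_nat.simps call_prog eq_body_def;
        rule runs_weaken, (rule runs_intros)+; simp)
next
  case (Suc i)
  show ?case
    by (cases j; simp only: enc_nat.simps call_prog eq_body_def;
        rule runs_weaken, (rule runs_intros Suc.IH)+; simp)
qed

lemma call_not: "call (prog main) not_fn [enc_bool x] (enc_bool (\<not> x)) 5"
  by (cases x; simp only: enc_bool_simps call_prog not_body_def;
      rule runs_weaken, (rule runs_intros)+; simp)

lemma call_or: "call (prog main) or_fn [enc_bool x, enc_bool y] (enc_bool (x \<or> y)) 5"
  by (cases x; simp only: enc_bool_simps call_prog or_body_def;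
      rule runs_weaken, (rule runs_intros)+; simp)

lemma call_and: "call (prog main) and_fn [enc_bool x, enc_bool y] (enc_bool (x \<and> y)) 5"
  by (cases x; simp only: enc_bool_simps call_prog and_body_def;
      rule runs_weaken, (rule runs_intros)+; simp)

lemma call_xor:
  "call (prog main) xor_fn [enc_bool x, enc_bool y, enc_bool z] (enc_bool (xor3 x y z)) 15"
  by (cases x; cases y; simp only: enc_bool_simps call_prog xor_body_def;
      rule runs_weaken, (rule call_not runs_intros)+; simp add: xor3_def)

lemma call_maj:
  "call (prog main) maj_fn [enc_bool x, enc_bool y, enc_bool z] (enc_bool (maj3 x y z)) 15"
  by (cases x; simp only: enc_bool_simps call_prog maj_body_def;
      rule runs_weaken, (rule call_or call_and runs_intros)+; simp add: maj3_def)

lemma call_add: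
  "call (prog main) add_fn [enc_bool c, enc_bool y, enc_bits xs, enc_bits zs]
     (enc_bits (add_bits c y xs zs)) (100 * Suc (length xs))"
proof (induction c y xs zs rule: add_bits.induct)
  case (1 c y zs)
  show ?case unfolding enc_bits_simps call_prog add_body_def Let_def
    by (rule runs_weaken, (rule runs_intros)+) simp_all
next
  case (2 c y x xs zs)
  show ?case unfolding enc_bits_simps call_prog add_body_def Let_def
    by (rule runs_weaken,
        (rule left_enc_bits right_enc_bits call_and call_xor call_maj 2[OF refl refl] runs_intros)+)
      (simp_all add: Let_def)
qed

lemma call_mul:
  "call (prog main) mul_fn [enc_bits acc, enc_bits xs, enc_bits ys] (enc_bits (mul_bits acc xs ys))
     (Suc (length ys) * (100 * Suc (length xs) + 30))"
proof (induction acc xs ys rule: mul_bits.induct)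
  case (1 acc xs)
  note add = call_add[of _ False False xs acc, unfolded enc_bool_simps]
  show ?case unfolding enc_bits_simps call_prog mul_body_def Let_def
    by (rule runs_weaken, (rule add runs_intros)+) simp_all
next
  case (2 acc xs y)
  note add = call_add[of _ False y xs acc, unfolded enc_bool_simps]
  show ?case unfolding enc_bits_simps call_prog mul_body_def Let_def
    by (rule runs_weaken, (rule add runs_intros)+) simp_all
next
  case (3 acc xs y y' ys)
  note add = call_add[of _ False y xs acc, unfolded enc_bool_simps]
  show ?case unfolding enc_bits_simps call_prog mul_body_def Let_def
    by (rule runs_weaken, (rule add right_enc_bits 3[unfolded enc_bits_simps] runs_intros)+)
      simp_all
qed

lemma call_pad:
  "call (prog main) pad_fn [enc_list us, enc_bits xs]
     (enc_bits (replicate (length us) False @ xs)) (10 * Suc (length us))"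
proof (induction us)
  case Nil
  show ?case unfolding enc_list_simps call_prog pad_body_def
    by (rule runs_weaken, (rule runs_intros)+) simp_all
next
  case (Cons u us)
  show ?case unfolding enc_list_simps call_prog pad_body_def
    by (rule runs_weaken, (rule runs_intros Cons.IH)+) simp_all
qed

lemma call_invert:
  "call (prog main) invert_fn [enc_bits xs] (enc_bits (map Not xs)) (20 * Suc (length xs))"
proof (induction xs)
  case Nil
  show ?case unfolding enc_bits_simps call_prog invert_body_def
    by (rule runs_weaken, (rule runs_intros)+) simp_all
next
  case (Cons x xs)
  show ?case unfolding enc_bits_simps call_prog invert_body_def
    by (rule runs_weaken, (rule call_not runs_intros Cons.IH)+) simp_all
qed

section \<open>Bottom-up evaluation of a DAG\<close>

lemma enc_node_simps:
  "enc_node num (NAtom a) = Br Lf (enc_nat (num a))"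
  "enc_node num (NNot i) = Br (Br Lf Lf) (enc_nat i)"
  "enc_node num (NAnd is) = Br (Br Lf (Br Lf Lf)) (enc_list (map enc_nat is))"
  "enc_node num (NOr is) = Br (Br Lf (Br Lf (Br Lf Lf))) (enc_list (map enc_nat is))"
  by (simp_all add: numeral_eq_Suc)

lemma enc_node_not_NAtom: "\<nexists>a. x = NAtom a \<Longrightarrow> \<exists>t u. enc_node num x = Br (Br Lf t) u"
  by (cases x) (simp_all add: enc_node_simps del: enc_node.simps)

lemma enc_dag_Cons: "enc_dag num (x # ns) = Br (enc_node num x) (enc_dag num ns)"
  by (simp add: enc_dag_def)

lemma enc_dag_Nil: "enc_dag num [] = Lf"
  by (simp add: enc_dag_def)

definition fold_cost :: "nat \<Rightarrow> nat \<Rightarrow> nat" where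
  "fold_cost C M = Suc M * (C + 10 * M + 20)"

definition node_cost :: "nat \<Rightarrow> nat \<Rightarrow> nat" where
  "node_cost C M = fold_cost C M + 10 * M + 30"

definition dag_cost :: "nat \<Rightarrow> nat \<Rightarrow> nat" where
  "dag_cost C M = Suc M * (node_cost C M + 10 * M + 40) + 10 * M + 20"

lemma call_fold:
  assumes body:
      "\<And>us w n. call (prog main) g us w n \<longleftrightarrow> runs (prog main) us (fold_body g comb unit) w n"
    and unit: "call (prog main) unit [d] (s []) C"
    and comb: "\<And>f fs. call (prog main) comb [r f, s fs] (s (f # fs)) C"
    and children: "\<forall>i\<in>set is. i < length fs" "length is \<le> M" and M: "length fs \<le> M"
  shows "call (prog main) g [enc_list (map enc_nat is), enc_list (map r fs), d]
    (s (map (\<lambda>i. fs ! i) is)) (fold_cost C M)"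
proof -
  have "call (prog main) g [enc_list (map enc_nat is), enc_list (map r fs), d]
    (s (map (\<lambda>i. fs ! i) is)) (Suc (length is) * (C + 10 * M + 20))"
    using children(1)
  proof (induction "is")
    case Nil
    show ?case unfolding list.map enc_list_simps body fold_body_def
      by (rule runs_weaken, (rule unit runs_intros)+) simp_all
  next
    case (Cons i "is")
    then have nth: "call (prog main) nth_fn [enc_list (map r fs), enc_nat i] (r (fs ! i)) (10 * M)"
      and rest: "call (prog main) g [enc_list (map enc_nat is), enc_list (map r fs), d]
        (s (map (\<lambda>i. fs ! i) is)) (Suc (length is) * (C + 10 * M + 20))"
      using M by (simp_all add: call_nth_map)
    show ?case unfolding list.map enc_list_simps body fold_body_def
      by (rule runs_weaken, (rule nth rest comb runs_intros)+) simp_all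
  qed
  then show ?thesis
    by (rule call_weaken) (unfold fold_cost_def, use children(2) in \<open>auto intro: mult_le_mono1\<close>)
qed

locale dag_evaluator =
  fixes main :: expr and b atom neg and_cons and_nil or_cons or_nil :: nat
    and num :: "'a \<Rightarrow> nat" and A :: "'a set" and d :: tree and val :: "'a fm \<Rightarrow> tree" and C :: nat
  assumes bodies:
      "take 5 (drop b (prog main)) = evaluator b atom neg and_cons and_nil or_cons or_nil"
    and call_atom: "\<And>a. a \<in> A \<Longrightarrow> call (prog main) atom [enc_nat (num a), d] (val (Atom a)) C"
    and call_neg: "\<And>f. call (prog main) neg [val f, d] (val (Neg f)) C"
    and call_and_nil: "call (prog main) and_nil [d] (val (And [])) C"
    and call_and_cons:
      "\<And>f fs. call (prog main) and_cons [val f, val (And fs)] (val (And (f # fs))) C"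
    and call_or_nil: "call (prog main) or_nil [d] (val (Or [])) C"
    and call_or_cons:
      "\<And>f fs. call (prog main) or_cons [val f, val (Or fs)] (val (Or (f # fs))) C"
begin

lemma call_evaluator:
  assumes "i < 5"
  shows "call (prog main) (b + i) us w n \<longleftrightarrow>
    runs (prog main) us (evaluator b atom neg and_cons and_nil or_cons or_nil ! i) w n"
proof -
  have "length (take 5 (drop b (prog main))) = 5"
    by (simp add: bodies) (simp add: evaluator_def)
  then have "b + i < length (prog main)" using assms by simp
  moreover have "prog main ! (b + i) = evaluator b atom neg and_cons and_nil or_cons or_nil ! i"
    using assms calculation by (simp flip: bodies)
  ultimately show ?thesis by (simp add: call_def)
qed

lemma call_bodies:
  "call (prog main) b us w n \<longleftrightarrow> runs (prog main) us (root_body (b + 1)) w n"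
  "call (prog main) (b + 1) us w n \<longleftrightarrow> runs (prog main) us (table_body (b + 1) (b + 2)) w n"
  "call (prog main) (b + 2) us w n \<longleftrightarrow> runs (prog main) us (node_body atom neg (b + 3) (b + 4)) w n"
  "call (prog main) (b + 3) us w n \<longleftrightarrow> runs (prog main) us (fold_body (b + 3) and_cons and_nil) w n"
  "call (prog main) (b + 4) us w n \<longleftrightarrow> runs (prog main) us (fold_body (b + 4) or_cons or_nil) w n"
  using call_evaluator[of 0] call_evaluator[of 1] call_evaluator[of 2] call_evaluator[of 3]
    call_evaluator[of 4]
  by (simp_all add: evaluator_def)

lemma call_node:
  assumes x: "\<And>a. x = NAtom a \<Longrightarrow> a \<in> A" "\<forall>i\<in>set (children x). i < length fs"
      "length (children x) \<le> M"
    and M: "length fs \<le> M"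
  shows "call (prog main) (b + 2) [enc_node num x, enc_list (map val fs), d]
    (val (node_fm fs x)) (node_cost C M)"
proof (cases x)
  case (NAtom a)
  show ?thesis unfolding NAtom enc_node_simps call_bodies node_body_def Let_def
    by (rule runs_weaken, (rule call_atom[OF x(1)[OF NAtom]] runs_intros)+)
      (simp_all add: node_cost_def fold_cost_def)
next
  case (NNot i)
  then have nth: "call (prog main) nth_fn [enc_list (map val fs), enc_nat i]
      (val (fs ! i)) (10 * M)"
    using x(2) M by (intro call_nth_map) simp_all
  show ?thesis unfolding NNot enc_node_simps call_bodies node_body_def Let_def
    by (rule runs_weaken, (rule nth call_neg runs_intros)+)
      (simp_all add: node_cost_def fold_cost_def)
next
  case (NAnd "is")
  have conj: "call (prog main) (b + 3) [enc_list (map enc_nat is), enc_list (map val fs), d]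
      (val (And (map (\<lambda>i. fs ! i) is))) (fold_cost C M)"
    by (rule call_fold[OF call_bodies(4) call_and_nil call_and_cons]) (use x M NAnd in simp_all)
  show ?thesis unfolding NAnd enc_node_simps call_bodies(3) node_body_def Let_def
    by (rule runs_weaken, (rule conj runs_intros)+) (simp_all add: node_cost_def)
next
  case (NOr "is")
  have disj: "call (prog main) (b + 4) [enc_list (map enc_nat is), enc_list (map val fs), d]
      (val (Or (map (\<lambda>i. fs ! i) is))) (fold_cost C M)"
    by (rule call_fold[OF call_bodies(5) call_or_nil call_or_cons]) (use x M NOr in simp_all)
  show ?thesis unfolding NOr enc_node_simps call_bodies(3) node_body_def Let_def
    by (rule runs_weaken, (rule disj runs_intros)+) (simp_all add: node_cost_def)
qed

lemma call_table:
  assumes "is_dag (ns @ ms)" "{a. NAtom a \<in> set (ns @ ms)} \<subseteq> A" "length (ns @ ms) \<le> M"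
  shows "call (prog main) (b + 1) [enc_dag num ms, enc_list (map val (dag_fms ns)), d]
    (enc_list (map val (dag_fms (ns @ ms)))) (Suc (length ms) * (node_cost C M + 10 * M + 40))"
  using assms
proof (induction ms arbitrary: ns)
  case Nil
  show ?case unfolding enc_dag_Nil call_bodies table_body_def
    by (rule runs_weaken, (rule runs_intros)+) simp_all
next
  case (Cons x ms)
  let ?call = "call (prog main)" and ?tab = "\<lambda>ns. enc_list (map val (dag_fms ns))"
  have "\<forall>i\<in>set (children x). i < length ns"
    using is_dag_child_less[OF Cons.prems(1), of "length ns"] by simp
  moreover have "length (children x) \<le> M"
    using length_children_le[OF Cons.prems(1), of x] Cons.prems(3) by simp
  ultimately have node: "?call (b + 2) [enc_node num x, ?tab ns, d]
      (val (node_fm (dag_fms ns) x)) (node_cost C M)"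
    using Cons.prems by (intro call_node) auto
  have snoc: "?call snoc_fn [?tab ns, val (node_fm (dag_fms ns) x)] (?tab (ns @ [x])) (10 * M)"
    by (rule call_weaken[OF call_snoc]) (use Cons.prems in \<open>simp_all add: dag_fms_snoc\<close>)
  have rest: "?call (b + 1) [enc_dag num ms, ?tab (ns @ [x]), d] (?tab (ns @ x # ms))
      (Suc (length ms) * (node_cost C M + 10 * M + 40))"
    using Cons.IH[of "ns @ [x]"] Cons.prems by simp
  show ?case unfolding enc_dag_Cons call_bodies table_body_def
    by (rule runs_weaken, (rule node snoc rest runs_intros)+) simp_all
qed

lemma call_dag_fm:
  assumes "is_dag ns" "atoms (dag_fm ns) \<subseteq> A" "length ns \<le> M"
  shows "call (prog main) b [enc_dag num ns, d] (val (dag_fm ns)) (dag_cost C M)"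
proof -
  have "call (prog main) (b + 1) [enc_dag num ns, enc_list (map val (dag_fms [])), d]
      (enc_list (map val (dag_fms ([] @ ns)))) (Suc (length ns) * (node_cost C M + 10 * M + 40))"
    by (rule call_table) (use assms atoms_dag_fm in auto)
  then have table: "call (prog main) (b + 1) [enc_dag num ns, Lf, d]
      (enc_list (map val (dag_fms ns))) (Suc M * (node_cost C M + 10 * M + 40))"
    by (simp only: dag_fms_Nil list.map enc_list_simps append_Nil, elim call_weaken)
      (use assms(3) in \<open>auto intro: mult_le_mono1\<close>)
  have "dag_fms ns \<noteq> []" using assms(1) by (metis is_dag_def length_0_conv length_dag_fms)
  then have last: "call (prog main) last_fn [enc_list (map val (dag_fms ns))]
      (val (dag_fm ns)) (10 * M)"
    by (intro call_weaken[OF call_last]) (use assms(3) in \<open>simp_all add: last_map dag_fm_def\<close>)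
  show ?thesis unfolding call_bodies root_body_def
    by (rule runs_weaken, (rule table last runs_intros)+) (simp_all add: dag_cost_def)
qed

end

section \<open>Polarities and clashes\<close>

definition enc_polarity :: "bool \<times> bool \<Rightarrow> tree" where
  "enc_polarity p = Br (enc_bool (fst p)) (enc_bool (snd p))"

lemma enc_polarity_proj:
  "left (enc_polarity p) = enc_bool (fst p)"
  "right (enc_polarity p) = enc_bool (snd p)"
  by (simp_all add: enc_polarity_def)

definition polarity_cost :: "nat \<Rightarrow> nat" where
  "polarity_cost M = dag_cost (10 * M + 40) M"

lemma call_polarity:
  assumes num: "inj_on num A" "a \<in> A" "num a \<le> M"
    and ns: "is_dag ns" "atoms (dag_fm ns) \<subseteq> A" "length ns \<le> M"
  shows "call (prog main) polarity_fn [enc_dag num ns, enc_nat (num a)]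
    (enc_polarity (polarity a (dag_fm ns))) (polarity_cost M)"
proof -
  let ?call = "call (prog main)" and ?val = "\<lambda>f. enc_polarity (polarity a f)" and ?C = "10 * M + 40"
  have atom: "?call polarity_atom_fn [enc_nat (num b), enc_nat (num a)] (?val (Atom b)) ?C"
    if "b \<in> A" for b
    unfolding call_prog polarity_atom_body_def
    by (rule runs_weaken, (rule call_eq runs_intros)+)
      (use num that in \<open>auto simp: enc_polarity_def inj_on_eq_iff\<close>)
  have neg: "?call polarity_neg_fn [?val f, d] (?val (Neg f)) ?C" for f d
    unfolding call_prog polarity_neg_body_def
    by (rule runs_weaken, (rule enc_polarity_proj runs_intros)+) (simp_all add: enc_polarity_def)
  have join: "?call polarity_join_fn [enc_polarity p, enc_polarity q]
      (enc_polarity (fst p \<or> fst q, snd p \<or> snd q)) ?C" for p q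
    unfolding call_prog polarity_join_body_def
    by (rule runs_weaken, (rule call_or enc_polarity_proj runs_intros)+)
      (simp_all add: enc_polarity_def)
  have none: "?call polarity_none_fn [d] (enc_polarity (False, False)) ?C" for d
    unfolding call_prog polarity_none_body_def
    by (rule runs_weaken, (rule runs_intros)+) (simp_all add: enc_polarity_def)
  have and_cons: "?call polarity_join_fn [?val f, ?val (And fs)] (?val (And (f # fs))) ?C" for f fs
    using join[of "polarity a f" "polarity a (And fs)"] by simp
  have or_cons: "?call polarity_join_fn [?val f, ?val (Or fs)] (?val (Or (f # fs))) ?C" for f fs
    using join[of "polarity a f" "polarity a (Or fs)"] by simp
  interpret dag_evaluator main polarity_fn polarity_atom_fn polarity_neg_fn polarity_join_fn
      polarity_none_fn polarity_join_fn polarity_none_fn num A "enc_nat (num a)" ?val ?C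
    by unfold_locales (fact prog_evaluators(1) atom neg and_cons or_cons | simp add: none)+
  show ?thesis unfolding polarity_cost_def using ns by (rule call_dag_fm)
qed

definition clash_cost :: "nat \<Rightarrow> nat" where
  "clash_cost M = Suc M * (2 * polarity_cost M + 70)"

lemma call_clash:
  assumes num: "inj_on num A" "\<forall>a\<in>A. num a \<le> M"
    and ns: "is_dag ns" "atoms (dag_fm ns) \<subseteq> A" "length ns \<le> M"
  shows "{a. NAtom a \<in> set ms} \<subseteq> A \<Longrightarrow> call (prog main) clash_fn [enc_dag num ms, enc_dag num ns]
    (enc_bool (\<exists>a. NAtom a \<in> set ms \<and> clashing (dag_fm ns) a))
    (Suc (length ms) * (2 * polarity_cost M + 70))"
    (is "_ \<Longrightarrow> call _ _ _ (enc_bool (?clash ms)) (?cost ms)")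
proof (induction ms)
  case Nil
  show ?case unfolding enc_dag_Nil call_prog clash_body_def Let_def
    by (rule runs_weaken, (rule runs_intros)+) simp_all
next
  case (Cons x ms)
  then have rest: "call (prog main) clash_fn [enc_dag num ms, enc_dag num ns]
      (enc_bool (?clash ms)) (?cost ms)"
    by auto
  show ?case
  proof (cases "\<exists>a. x = NAtom a")
    case True
    then obtain a where x: "x = NAtom a" by blast
    let ?p = "polarity a (dag_fm ns)"
    have "a \<in> A" using Cons.prems x by auto
    then have polarity: "call (prog main) polarity_fn [enc_dag num ns, enc_nat (num a)]
        (enc_polarity ?p) (polarity_cost M)"
      using num ns by (intro call_polarity) simp_all
    have iff: "?clash (x # ms) \<longleftrightarrow> fst ?p \<and> snd ?p \<or> ?clash ms"
      by (auto simp: x clashing_def)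
    show ?thesis
      unfolding iff unfolding enc_dag_Cons x enc_node_simps call_prog clash_body_def Let_def
      by (rule runs_weaken,
          (rule rest polarity enc_polarity_proj call_and call_or runs_intros)+) simp_all
  next
    case False
    then obtain t u where x: "enc_node num x = Br (Br Lf t) u" using enc_node_not_NAtom by blast
    have iff: "?clash (x # ms) \<longleftrightarrow> ?clash ms" using False by auto
    show ?thesis unfolding iff unfolding enc_dag_Cons x call_prog clash_body_def Let_def
      by (rule runs_weaken, (rule rest runs_intros)+) simp_all
  qed
qed

section \<open>Weights\<close>

lemma call_literal:
  assumes "us \<noteq> []"
  shows "call (prog main) literal_fn [enc_polarity p, enc_list us]
    (enc_bits (literal_bits (length us) p)) (10 * length us + 40)"
proof -
  obtain u vs where us: "us = u # vs" using assms by (cases us) auto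
  note pads = call_pad[of _ us "[True]", unfolded enc_bits_simps enc_bool_simps]
    call_pad[of _ us "[False]", unfolded enc_bits_simps enc_bool_simps]
    call_pad[of _ vs "[True, False]", unfolded enc_bits_simps enc_bool_simps]
  have tail: "right (enc_list us) = enc_list vs" by (simp add: us)
  have len: "length us - 1 = length vs" "length us = Suc (length vs)" by (simp_all add: us)
  show ?thesis
    unfolding call_prog literal_body_def
    by (cases "fst p"; cases "snd p"; simp only: enc_polarity_def enc_bool_simps;
        rule runs_weaken, (rule pads tail runs_intros)+;
        simp add: literal_bits_def one_bits_def zero_bits_def half_bits_def len
          del: replicate.simps)
qed

lemma call_weight_atom:
  assumes "us \<noteq> []" "inj_on num A" "a \<in> A" "num a \<le> M"
    and "is_dag ms" "atoms (dag_fm ms) \<subseteq> A" "length ms \<le> M"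
  shows "call (prog main) weight_atom_fn [enc_nat (num a), Br (enc_list us) (enc_dag num ms)]
    (enc_bits (literal_bits (length us) (polarity a (dag_fm ms))))
    (polarity_cost M + 10 * length us + 60)"
  unfolding call_prog weight_atom_body_def
  by (rule runs_weaken,
      (rule call_polarity[OF assms(2-7)] call_literal[OF assms(1)] runs_intros)+) simp_all

lemma call_one:
  "call (prog main) one_fn [Br (enc_list us) v] (enc_bits (one_bits (length us)))
    (10 * length us + 30)"
proof -
  note pad =
    call_pad[of _ us "[True]", unfolded enc_bits_simps enc_bool_simps, folded one_bits_def]
  show ?thesis unfolding call_prog one_body_def
    by (rule runs_weaken, (rule pad runs_intros)+) simp_all
qed

lemma call_zero:
  "call (prog main) zero_fn [Br (enc_list us) v] (enc_bits (zero_bits (length us)))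
    (10 * length us + 30)"
proof -
  note pad =
    call_pad[of _ us "[False]", unfolded enc_bits_simps enc_bool_simps, folded zero_bits_def]
  show ?thesis unfolding call_prog zero_body_def
    by (rule runs_weaken, (rule pad runs_intros)+) simp_all
qed

lemma call_weight_neg:
  assumes "length xs = Suc (length us)"
  shows "call (prog main) weight_neg_fn [enc_bits xs, Br (enc_list us) v]
    (enc_bits (complement_bits (length us) xs)) (130 * length us + 350)"
proof -
  note add = call_add[of _ True True, unfolded enc_bool_simps]
  show ?thesis unfolding call_prog weight_neg_body_def
    by (rule runs_weaken, (rule call_one call_invert add runs_intros)+)
      (simp_all add: complement_bits_def assms)
qed

lemma call_plus:
  "call (prog main) plus_fn [enc_bits xs, enc_bits ys] (enc_bits (add_bits False True xs ys))
    (100 * length xs + 120)"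
proof -
  note add = call_add[of _ False True, unfolded enc_bool_simps]
  show ?thesis unfolding call_prog plus_body_def
    by (rule runs_weaken, (rule add runs_intros)+) simp_all
qed

lemma call_times:
  "call (prog main) times_fn [enc_bits xs, enc_bits ys] (enc_bits (mul_bits [] xs ys))
    (Suc (length ys) * (100 * Suc (length xs) + 30) + 10)"
proof -
  note mul = call_mul[of _ "[]", unfolded enc_bits_simps]
  show ?thesis unfolding call_prog times_body_def
    by (rule runs_weaken, (rule mul runs_intros)+) simp_all
qed

definition weight_step_cost :: "nat \<Rightarrow> nat" where
  "weight_step_cost M = polarity_cost M + (M + 2) * (100 * (M + 2) + 30) + 130 * M + 350"

definition weight_cost :: "nat \<Rightarrow> nat" where
  "weight_cost M = dag_cost (weight_step_cost M) M"

lemma call_weight: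
  assumes num: "inj_on num A" "\<forall>a\<in>A. num a \<le> M"
    and ns: "is_dag ns" "atoms (dag_fm ns) \<subseteq> A" "length ns \<le> M"
    and ms: "is_dag ms" "atoms (dag_fm ms) \<subseteq> A" "length ms \<le> M"
  shows "call (prog main) weight_fn [enc_dag num ns, Br (enc_dag num ns) (enc_dag num ms)]
    (enc_bits (weight (length ns) (\<lambda>a. polarity a (dag_fm ms)) (dag_fm ns))) (weight_cost M)"
proof -
  define us where "us = map (enc_node num) ns"
  let ?call = "call (prog main)" and ?w = "weight (length us) (\<lambda>a. polarity a (dag_fm ms))"
    and ?d = "Br (enc_list us) (enc_dag num ms)" and ?C = "weight_step_cost M"
  have us: "us \<noteq> []" "length us \<le> M" using ns by (auto simp: us_def is_dag_def)
  then have len: "length (?w f) = Suc (length us)" for f by (simp add: length_weight)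
  have le_C: "polarity_cost M + 20 * length us + 60 \<le> ?C" "130 * length us + 350 \<le> ?C"
    using us(2) by (simp_all add: weight_step_cost_def)
  have atom: "?call weight_atom_fn [enc_nat (num a), ?d] (enc_bits (?w (Atom a))) ?C"
    if "a \<in> A" for a
    by (rule call_weaken[OF call_weight_atom[OF us(1) num(1) that _ ms]])
      (use le_C num(2) that in simp_all)
  have neg: "?call weight_neg_fn [enc_bits (?w f), ?d] (enc_bits (?w (Neg f))) ?C" for f
    by (rule call_weaken[OF call_weight_neg[OF len]]) (use le_C in simp_all)
  have and_nil: "?call one_fn [?d] (enc_bits (?w (And []))) ?C"
    by (rule call_weaken[OF call_one]) (use le_C in simp_all)
  have or_nil: "?call zero_fn [?d] (enc_bits (?w (Or []))) ?C"
    by (rule call_weaken[OF call_zero]) (use le_C in simp_all)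
  have "Suc (Suc (length us)) * (100 * Suc (Suc (length us)) + 30) \<le> (M + 2) * (100 * (M + 2) + 30)"
    using us(2) by (intro mult_le_mono) simp_all
  then have "?call times_fn [enc_bits (?w f), enc_bits (?w g)]
      (enc_bits (mul_bits [] (?w f) (?w g))) ?C" for f g
    by (intro call_weaken[OF call_times]) (simp_all add: len weight_step_cost_def)
  from this[of _ "And _"] have and_cons: "?call times_fn [enc_bits (?w f), enc_bits (?w (And fs))]
      (enc_bits (?w (And (f # fs)))) ?C" for f fs
    by simp
  have or_cons: "?call plus_fn [enc_bits (?w f), enc_bits (?w (Or fs))]
      (enc_bits (?w (Or (f # fs)))) ?C" for f fs
    by (rule call_weaken[OF call_plus]) (use le_C in \<open>simp_all add: len\<close>)
  interpret dag_evaluator main weight_fn weight_atom_fn weight_neg_fn times_fn one_fn plus_fn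
      zero_fn num A ?d "\<lambda>f. enc_bits (?w f)" ?C
    by unfold_locales (fact prog_evaluators(2) atom neg and_nil and_cons or_nil or_cons)+
  have "?call weight_fn [enc_dag num ns, ?d] (enc_bits (?w (dag_fm ns))) (dag_cost ?C M)"
    using ns by (rule call_dag_fm)
  then show ?thesis by (simp add: us_def weight_cost_def enc_dag_def)
qed

section \<open>Deciding entailment and validity\<close>

lemma is_numbering_dags:
  assumes "is_dag \<psi>" "is_dag \<gamma>" "is_numbering num (atoms (dag_fm \<psi>) \<union> atoms (dag_fm \<gamma>))"
  shows "inj_on num (atoms (dag_fm \<psi>) \<union> atoms (dag_fm \<gamma>))"
    and "\<forall>a \<in> atoms (dag_fm \<psi>) \<union> atoms (dag_fm \<gamma>). num a \<le> length \<psi> + length \<gamma>"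
proof -
  let ?A = "atoms (dag_fm \<psi>) \<union> atoms (dag_fm \<gamma>)"
  have "card ?A \<le> card (atoms (dag_fm \<psi>)) + card (atoms (dag_fm \<gamma>))"
    by (rule card_Un_le)
  also have "\<dots> \<le> length \<psi> + length \<gamma>"
    using assms(1,2) by (intro add_mono card_atoms_dag_fm_le)
  finally have "card ?A \<le> length \<psi> + length \<gamma>" .
  moreover have "\<forall>a\<in>?A. num a < card ?A"
    using bij_betwE[OF assms(3)[unfolded is_numbering_def]] by simp
  ultimately show "\<forall>a\<in>?A. num a \<le> length \<psi> + length \<gamma>"
    by (meson less_imp_le order_trans)
  show "inj_on num ?A" using assms(3) by (simp add: is_numbering_def bij_betw_def)
qed

definition entails_cost :: "nat \<Rightarrow> nat" where
  "entails_cost M = clash_cost M + weight_cost M + 10 * M + 40"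

lemma call_entails:
  assumes \<psi>: "is_dag \<psi>" "decomposable (dag_fm \<psi>)" "deterministic (dag_fm \<psi>)"
    and \<gamma>: "is_dag \<gamma>" "is_cube (dag_fm \<gamma>)"
    and num: "is_numbering num (atoms (dag_fm \<psi>) \<union> atoms (dag_fm \<gamma>))"
  shows "call (prog main) entails_fn [enc_dag num \<psi>, enc_dag num \<gamma>]
    (enc_bool (prop_entails (dag_fm \<gamma>) (dag_fm \<psi>))) (entails_cost (length \<psi> + length \<gamma>))"
proof -
  define M where "M = length \<psi> + length \<gamma>"
  let ?A = "atoms (dag_fm \<psi>) \<union> atoms (dag_fm \<gamma>)"
  let ?w = "weight (length \<psi>) (\<lambda>a. polarity a (dag_fm \<gamma>)) (dag_fm \<psi>)"
  note num = is_numbering_dags[OF \<psi>(1) \<gamma>(1) num, folded M_def]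
  have "0 < length \<psi>" using \<psi>(1) by (simp add: is_dag_def)
  then have len: "length ?w = Suc (length \<psi>)"
    and iff: "prop_entails (dag_fm \<gamma>) (dag_fm \<psi>) \<longleftrightarrow> (\<exists>a. clashing (dag_fm \<gamma>) a) \<or> last ?w"
    using prop_entails_iff_weight[OF \<psi>(2,3) finite_atoms card_atoms_dag_fm_le[OF \<psi>(1)] _ \<gamma>(2)]
    by (simp_all add: length_weight)
  have "call (prog main) clash_fn [enc_dag num \<gamma>, enc_dag num \<gamma>]
      (enc_bool (\<exists>a. NAtom a \<in> set \<gamma> \<and> clashing (dag_fm \<gamma>) a))
      (Suc (length \<gamma>) * (2 * polarity_cost M + 70))"
    by (rule call_clash[OF num \<gamma>(1)]) (use \<gamma>(1) in \<open>auto simp: M_def atoms_dag_fm\<close>)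
  moreover have "(\<exists>a. NAtom a \<in> set \<gamma> \<and> clashing (dag_fm \<gamma>) a) \<longleftrightarrow> (\<exists>a. clashing (dag_fm \<gamma>) a)"
    using polarity_in_atoms[of _ "dag_fm \<gamma>"] unfolding clashing_def atoms_dag_fm[OF \<gamma>(1)] by blast
  ultimately have clash: "call (prog main) clash_fn [enc_dag num \<gamma>, enc_dag num \<gamma>]
      (enc_bool (\<exists>a. clashing (dag_fm \<gamma>) a)) (clash_cost M)"
    by (elim call_weaken) (simp_all add: clash_cost_def M_def)
  have weight: "call (prog main) weight_fn [enc_dag num \<psi>, Br (enc_dag num \<psi>) (enc_dag num \<gamma>)]
      (enc_bits ?w) (weight_cost M)"
    by (rule call_weight[OF num]) (use \<psi>(1) \<gamma>(1) in \<open>auto simp: M_def\<close>)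
  have last: "call (prog main) last_fn [enc_bits ?w] (enc_bool (last ?w)) (10 * Suc M)"
  proof -
    have "?w \<noteq> []" using len by auto
    then show ?thesis unfolding enc_bits_def
      by (intro call_weaken[OF call_last]) (simp_all add: len M_def last_map)
  qed
  show ?thesis unfolding call_prog entails_body_def
    by (rule runs_weaken, (rule clash weight last call_or runs_intros)+)
      (simp_all add: iff entails_cost_def M_def)
qed

definition T_entails_main :: expr where
  "T_entails_main = ECall entails_fn [Arg 0, Arg 1]"

text \<open>The second argument is the encoding of the empty conjunction.\<close>

definition T_valid_main :: expr where
  "T_valid_main = ECall entails_fn [Arg 0, EBr (EBr (EBr ELf ETrue) ELf) ELf]"

lemma decides_within_prog:
  assumes "runs (prog main) us main (enc_bool b) n"
  shows "decides_within (prog main) us b n"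
proof -
  have "prog main \<noteq> []" "hd (prog main) = main" "enc_bool b \<noteq> Lf \<longleftrightarrow> b"
    by (simp_all add: prog_def enc_bool_def)
  then show ?thesis using assms unfolding decides_within_def runs_def by metis
qed

lemma d_DNNF_abstraction:
  assumes "d_DNNF (abstraction f)"
  shows "decomposable f" "deterministic f"
  using assms by (simp_all add: d_DNNF_def decomposable_abstraction deterministic_abstraction)

lemma decides_T_entails:
  assumes \<psi>: "is_dag \<psi>" "d_DNNF (abstraction (dag_fm \<psi>))"
    and \<alpha>: "finite \<alpha>" "atoms (dag_fm \<psi>) \<subseteq> \<alpha>" "T_extended \<Sigma> T \<alpha> (dag_fm \<psi>)"
    and \<gamma>: "is_dag \<gamma>" "is_cube (dag_fm \<gamma>)" "atoms (dag_fm \<gamma>) \<subseteq> \<alpha>"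
    and num: "is_numbering num (atoms (dag_fm \<psi>) \<union> atoms (dag_fm \<gamma>))"
  shows "decides_within (prog T_entails_main) [enc_dag num \<psi>, enc_dag num \<gamma>]
    (T_entails \<Sigma> T (dag_fm \<gamma>) (dag_fm \<psi>)) (entails_cost (dag_size \<psi> + dag_size \<gamma>) + 3)"
proof -
  note entails = call_entails[OF \<psi>(1) d_DNNF_abstraction[OF \<psi>(2)] \<gamma>(1,2) num,
      folded T_entails_iff_prop_entails[OF \<alpha>(1,2) \<gamma>(3) \<alpha>(3)]]
  have "runs (prog T_entails_main) [enc_dag num \<psi>, enc_dag num \<gamma>] (ECall entails_fn [Arg 0, Arg 1])
      (enc_bool (T_entails \<Sigma> T (dag_fm \<gamma>) (dag_fm \<psi>))) (entails_cost (dag_size \<psi> + dag_size \<gamma>) + 3)"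
    unfolding dag_size_def by (rule runs_weaken, (rule entails runs_intros)+) simp_all
  then show ?thesis by (intro decides_within_prog) (simp only: T_entails_main_def)
qed

lemma decides_T_valid:
  fixes \<psi> :: "('p, 'f, 'v, 'b) atom dag"
  assumes \<psi>: "is_dag \<psi>" "d_DNNF (abstraction (dag_fm \<psi>))"
    and \<alpha>: "finite \<alpha>" "atoms (dag_fm \<psi>) \<subseteq> \<alpha>" "T_extended \<Sigma> T \<alpha> (dag_fm \<psi>)"
    and num: "is_numbering num (atoms (dag_fm \<psi>))"
  shows "decides_within (prog T_valid_main) [enc_dag num \<psi>] (T_valid \<Sigma> T (dag_fm \<psi>))
    (entails_cost (Suc (dag_size \<psi>)) + 11)"
proof -
  let ?top = "[NAnd []] :: ('p, 'f, 'v, 'b) atom dag"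
  have fm: "dag_fm ?top = And []" by (simp add: dag_fm_def dag_fms_def)
  have "is_dag ?top" "is_cube (dag_fm ?top)" by (simp_all add: is_dag_def is_cube_def fm)
  then have "call (prog T_valid_main) entails_fn [enc_dag num \<psi>, enc_dag num ?top]
      (enc_bool (prop_entails (dag_fm ?top) (dag_fm \<psi>))) (entails_cost (length \<psi> + length ?top))"
    using num by (intro call_entails \<psi>(1) d_DNNF_abstraction[OF \<psi>(2)]) (simp_all add: fm)
  moreover have "enc_dag num ?top = Br (Br (Br Lf (Br Lf Lf)) Lf) Lf"
    by (simp add: enc_dag_Cons enc_dag_Nil enc_node_simps del: enc_node.simps)
  moreover have "prop_entails (dag_fm ?top) (dag_fm \<psi>) \<longleftrightarrow> T_valid \<Sigma> T (dag_fm \<psi>)"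
    using T_entails_iff_prop_entails[OF \<alpha>(1,2) _ \<alpha>(3), of "And []"]
    by (simp add: fm T_entails_def T_valid_def)
  ultimately have entails: "call (prog T_valid_main) entails_fn
      [enc_dag num \<psi>, Br (Br (Br Lf (Br Lf Lf)) Lf) Lf]
      (enc_bool (T_valid \<Sigma> T (dag_fm \<psi>))) (entails_cost (Suc (length \<psi>)))"
    by simp
  have "runs (prog T_valid_main) [enc_dag num \<psi>]
      (ECall entails_fn [Arg 0, EBr (EBr (EBr ELf ETrue) ELf) ELf])
      (enc_bool (T_valid \<Sigma> T (dag_fm \<psi>))) (entails_cost (Suc (dag_size \<psi>)) + 11)"
    unfolding dag_size_def by (rule runs_weaken, (rule entails runs_intros)+) simp_all
  then show ?thesis by (intro decides_within_prog) (simp only: T_valid_main_def)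
qed

section \<open>Polynomial running time\<close>

definition polynomial_fun :: "('a \<Rightarrow> 'a::comm_semiring_1) \<Rightarrow> bool" where
  "polynomial_fun f \<longleftrightarrow> (\<exists>q. \<forall>x. f x = poly q x)"

lemma polynomial_fun_const: "polynomial_fun (\<lambda>x. c)"
  unfolding polynomial_fun_def by (rule exI[of _ "[:c:]"]) simp

lemma polynomial_fun_id: "polynomial_fun (\<lambda>x. x)"
  unfolding polynomial_fun_def by (rule exI[of _ "[:0, 1:]"]) simp

lemma polynomial_fun_add:
  "polynomial_fun f \<Longrightarrow> polynomial_fun g \<Longrightarrow> polynomial_fun (\<lambda>x. f x + g x)"
  unfolding polynomial_fun_def by (metis poly_add)

lemma polynomial_fun_mult:
  "polynomial_fun f \<Longrightarrow> polynomial_fun g \<Longrightarrow> polynomial_fun (\<lambda>x. f x * g x)"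
  unfolding polynomial_fun_def by (metis poly_mult)

lemma polynomial_fun_Suc: "polynomial_fun f \<Longrightarrow> polynomial_fun (\<lambda>x. Suc (f x))"
  using polynomial_fun_add[OF polynomial_fun_const[of 1], of f] by simp

lemmas polynomial_fun_intros =
  polynomial_fun_const polynomial_fun_id polynomial_fun_add polynomial_fun_mult polynomial_fun_Suc

lemma polynomial_fun_entails_cost:
  "polynomial_fun f \<Longrightarrow> polynomial_fun (\<lambda>x. entails_cost (f x))"
  unfolding entails_cost_def clash_cost_def weight_cost_def weight_step_cost_def polarity_cost_def
    dag_cost_def node_cost_def fold_cost_def
  by (intro polynomial_fun_intros)

theorem theorem5p4:
  fixes \<Sigma> :: "('p, 'f, 'v, 's) signature"
    and T :: "('p, 'f, 's, 'u) struct set"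
  assumes "is_theory \<Sigma> T"
  shows
    "(\<exists>P q. \<forall>(\<psi> :: ('p, 'f, 'v, 'b) atom dag) \<alpha> num.
       is_dag \<psi> \<and> d_DNNF (abstraction (dag_fm \<psi>)) \<and>
       finite \<alpha> \<and> (\<forall>a\<in>\<alpha>. well_sorted \<Sigma> a) \<and> atoms (dag_fm \<psi>) \<subseteq> \<alpha> \<and>
       T_extended \<Sigma> T \<alpha> (dag_fm \<psi>) \<and>
       is_numbering num (atoms (dag_fm \<psi>)) \<longrightarrow>
       decides_within P [enc_dag num \<psi>] (T_valid \<Sigma> T (dag_fm \<psi>)) (poly q (dag_size \<psi>))) \<and>
     (\<exists>P q. \<forall>(\<psi> :: ('p, 'f, 'v, 'b) atom dag) \<alpha> \<gamma> num.
       is_dag \<psi> \<and> d_DNNF (abstraction (dag_fm \<psi>)) \<and>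
       finite \<alpha> \<and> (\<forall>a\<in>\<alpha>. well_sorted \<Sigma> a) \<and> atoms (dag_fm \<psi>) \<subseteq> \<alpha> \<and>
       T_extended \<Sigma> T \<alpha> (dag_fm \<psi>) \<and>
       is_dag \<gamma> \<and> is_cube (dag_fm \<gamma>) \<and> atoms (dag_fm \<gamma>) \<subseteq> \<alpha> \<and>
       is_numbering num (atoms (dag_fm \<psi>) \<union> atoms (dag_fm \<gamma>)) \<longrightarrow>
       decides_within P [enc_dag num \<psi>, enc_dag num \<gamma>]
         (T_entails \<Sigma> T (dag_fm \<gamma>) (dag_fm \<psi>)) (poly q (dag_size \<psi> + dag_size \<gamma>)))"
  (is "?validity \<and> ?entailment")
proof
  have "polynomial_fun (\<lambda>x. entails_cost (Suc x) + 11)"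
    by (intro polynomial_fun_intros polynomial_fun_entails_cost)
  then obtain q where q: "\<And>x. entails_cost (Suc x) + 11 = poly q x"
    unfolding polynomial_fun_def by blast
  show ?validity
    by (intro exI[of _ "prog T_valid_main"] exI[of _ q]) (auto intro: decides_T_valid simp flip: q)
next
  have "polynomial_fun (\<lambda>x. entails_cost x + 3)"
    by (intro polynomial_fun_intros polynomial_fun_entails_cost)
  then obtain q where q: "\<And>x. entails_cost x + 3 = poly q x"
    unfolding polynomial_fun_def by blast
  show ?entailment
    by (intro exI[of _ "prog T_entails_main"] exI[of _ q])
      (auto intro: decides_T_entails simp flip: q)
qed

end
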